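(* Let a tuple of masks (independent of $h$) be given such that, for every $h>0$, the associated operator $\mathcal{Q}^{\ast}$, $f\mapsto \mathcal{Q}^*[f]$ (defined in the context), is exact on $\mathbb{P}_2$ (that is, $\mathcal{Q}^{\ast}[p]=p$ for every bivariate polynomial $p$ of total degree at most $2$) and satisfies $\mathcal{Q}^{\ast}[f]\in S_3^1(\Delta_3)$ for every $f\in C^1(\mathbb{R}^2)$. Then the quasi-interpolation error $\varepsilon[f]=f-\mathcal{Q}^{\ast}[f]$ is of order four at the midpoints of the sides of $\Delta_3$ if and only if there is a real number $\lambda$ such that $$\alpha_{0,0,2}=\lambda,\quad \alpha_{0,0,3}=\tfrac16(-5+12\lambda),\quad \alpha_{1,0,2}=\tfrac1{36}(1-18\lambda),\quad \alpha_{1,0,3}=\tfrac1{12}(5-18\lambda),\quad \alpha_{0,1,2}=-\tfrac19 ,$$ $\lambda$ being an arbitrary value.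
   Context: Triangulation. For $h>0$ let $e_1=(h,h)$, $e_2=(h,-h)$ and $v_{i,j}=ie_1+je_2$, $i,j\in\mathbb{Z}$. The uniform three-direction triangulation $\Delta_3$ of $\mathbb{R}^2$ consists of the triangles $T_{i,j}=[v_{i,j},v_{i+1,j+1},v_{i+1,j}]$ and $\widetilde T_{i,j}=[v_{i,j},v_{i+1,j+1},v_{i,j+1}]$, $i,j\in\mathbb{Z}$. $S_3^1(\Delta_3)$ is the space of $C^1$ functions on $\mathbb{R}^2$ whose restriction to each triangle of $\Delta_3$ is a polynomial of total degree at most $3$. The sides of $\Delta_3$ are the edges $[v_{i,j},v_{i+k,j+\ell}]$, $k,\ell\in\{0,1\}$, $k+\ell\neq0$, $i,j\in\mathbb{Z}$. Bernstein polynomials. For a triangle with ordered vertices $(w_1,w_2,w_3)$ and barycentric coordinates $(\tau_1,\tau_2,\tau_3)$ with respect to it, $B_{\alpha_1,\alpha_2,\alpha_3}=\frac{3!}{\alpha_1!\alpha_2!\alpha_3!}\tau_1^{\alpha_1}\tau_2^{\alpha_2}\tau_3^{\alpha_3}$, $\alpha_1+\alpha_2+\alpha_3=3$. For $T_{i,j}$ the vertices are ordered as $(v_{i,j},v_{i+1,j+1},v_{i+1,j})$, and for $\widetilde T_{i,j}$ as $(v_{i,j+1},v_{i+1,j+1},v_{i,j})$. Masks. For a function $g$ on $\mathbb{R}^2$ put $g_{i,j}=(g(v_{i,j}),g(v_{i+1,j+1}),g(v_{i+1,j}),g(v_{i,j-1}),g(v_{i-1,j-1}),g(v_{i-1,j}),g(v_{i,j+1}))\in\mathbb{R}^7$.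 Masks are vectors in $\mathbb{R}^7$ with entries indexed $0,\dots,6$ (so $\alpha_{0,0}=(\alpha_{0,0,\ell})_{0\le\ell\le6}$, $\alpha_{1,0}=(\alpha_{1,0,\ell})_{0\le\ell\le6}$, $\alpha_{0,1}=(\alpha_{0,1,\ell})_{0\le\ell\le6}$); the product of a mask and such a vector is the Euclidean inner product. Let $K=\{(k,m)\in\{-1,0,1\}^2: k+m\neq 0\}$ (six pairs). Given masks $\alpha_{0,0},\alpha_{1,0},\alpha_{0,1}$; $\beta^{k,m}_{0,0},\beta^{k,m}_{1,0},\beta^{k,m}_{0,1}$ for $(k,m)\in K$; $\gamma_{0,0},\gamma_{1,0},\gamma_{0,1}$; $\widetilde\gamma_{0,0},\widetilde\gamma_{1,0},\widetilde\gamma_{0,1}$, define for $f\in C^1(\mathbb{R}^2)$ and $i,j\in\mathbb{Z}$, with $\partial_{1,0}f,\partial_{0,1}f$ the partial derivatives in $x$ and $y$, $$V_{i,j}=\alpha_{0,0}f_{i,j}+\alpha_{1,0}\,h\,\partial_{1,0}f_{i,j}+\alpha_{0,1}\,h\,\partial_{0,1}f_{i,j},\qquad U^{k,m}_{i,j}=\beta^{k,m}_{0,0}f_{i,j}+\beta^{k,m}_{1,0}\,h\,\partial_{1,0}f_{i,j}+\beta^{k,m}_{0,1}\,h\,\partial_{0,1}f_{i,j},$$ $$C_{i,j}=\gamma_{0,0}f_{i,j}+\gamma_{1,0}\,h\,\partial_{1,0}f_{i,j}+\gamma_{0,1}\,h\,\partial_{0,1}f_{i,j},\qquad \widetilde C_{i,j}=\widetilde\gamma_{0,0}f_{i,j}+\widetilde\gamma_{1,0}\,h\,\partial_{1,0}f_{i,j}+\widetilde\gamma_{0,1}\,h\,\partial_{0,1}f_{i,j}.$$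 Operator. $Qf=\mathcal{Q}^*[f]$ is the continuous piecewise cubic function on $\Delta_3$ given by $$Qf|_{T_{i,j}}=V_{i,j}B_{3,0,0}+U_{i,j}^{1,1}B_{2,1,0}+U_{i,j}^{1,0}B_{2,0,1}+U_{i+1,j+1}^{-1,-1}B_{1,2,0}+C_{i,j}B_{1,1,1}+U_{i+1,j}^{-1,0}B_{1,0,2}+V_{i+1,j+1}B_{0,3,0}+U_{i+1,j+1}^{0,-1}B_{0,2,1}+U_{i+1,j}^{0,1}B_{0,1,2}+V_{i+1,j}B_{0,0,3},$$ $$Qf|_{\widetilde T_{i,j}}=V_{i,j+1}B_{3,0,0}+U_{i,j+1}^{1,0}B_{2,1,0}+U_{i,j+1}^{0,-1}B_{2,0,1}+U_{i+1,j+1}^{-1,0}B_{1,2,0}+\widetilde C_{i,j}B_{1,1,1}+U_{i,j}^{0,1}B_{1,0,2}+V_{i+1,j+1}B_{0,3,0}+U_{i+1,j+1}^{-1,-1}B_{0,2,1}+U_{i,j}^{1,1}B_{0,1,2}+V_{i,j}B_{0,0,3},$$ where the Bernstein polynomials are those of the triangle in question with the vertex order fixed above. Order four. With the masks fixed, the error is said to be of order four (meaning order at least four) at a family of points of $\Delta_3$ (here, the midpoints of its sides) if for every $f\in C^4(\mathbb{R}^2)$ with bounded fourth-order partial derivatives one has $\sup_q|\varepsilon[f](q)|=O(h^4)$ as $h\to0$, the supremum being over all points $q$ of the family for the given $h$. *)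

theory Defs
  imports "HOL-Analysis.Analysis"
begin

type_synonym plane = "real \<times> real"

definition partial_x :: "(plane \<Rightarrow> real) \<Rightarrow> plane \<Rightarrow> real" where
  "partial_x f = (\<lambda>(x, y). deriv (\<lambda>t. f (t, y)) x)"

definition partial_y :: "(plane \<Rightarrow> real) \<Rightarrow> plane \<Rightarrow> real" where
  "partial_y f = (\<lambda>(x, y). deriv (\<lambda>t. f (x, t)) y)"

text \<open>
  \<open>Ck k f\<close>: all partial derivatives of order at most $k$ exist and are continuous.
  The existence clause is essential, since \<open>deriv\<close> is total.
\<close>

fun Ck :: "nat \<Rightarrow> (plane \<Rightarrow> real) \<Rightarrow> bool" where
  "Ck 0 f \<longleftrightarrow> continuous_on UNIV f"
| "Ck (Suc k) f \<longleftrightarrow> continuous_on UNIV f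
     \<and> (\<forall>x y. (\<lambda>t. f (t, y)) differentiable (at x) \<and> (\<lambda>t. f (x, t)) differentiable (at y))
     \<and> Ck k (partial_x f) \<and> Ck k (partial_y f)"

definition bounded_fourth_partials :: "(plane \<Rightarrow> real) \<Rightarrow> bool" where
  "bounded_fourth_partials f \<longleftrightarrow>
     (\<forall>a b. a + b = 4 \<longrightarrow> bounded (range ((partial_x ^^ a) ((partial_y ^^ b) f))))"

definition polys_upto :: "nat \<Rightarrow> (plane \<Rightarrow> real) set" where
  "polys_upto n = {p. \<exists>c :: nat \<Rightarrow> nat \<Rightarrow> real.
     \<forall>x y. p (x, y) = (\<Sum>a\<le>n. \<Sum>b\<le>n - a. c a b * x ^ a * y ^ b)}"


definition vtx :: "real \<Rightarrow> int \<Rightarrow> int \<Rightarrow> plane" where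
  "vtx h i j = of_int i *\<^sub>R (h, h) + of_int j *\<^sub>R (h, - h)"

definition tri_T :: "real \<Rightarrow> int \<Rightarrow> int \<Rightarrow> plane set" where
  "tri_T h i j = convex hull {vtx h i j, vtx h (i + 1) (j + 1), vtx h (i + 1) j}"

definition tri_T' :: "real \<Rightarrow> int \<Rightarrow> int \<Rightarrow> plane set" where
  "tri_T' h i j = convex hull {vtx h i j, vtx h (i + 1) (j + 1), vtx h i (j + 1)}"

definition side_midpoints :: "real \<Rightarrow> plane set" where
  "side_midpoints h = {midpoint (vtx h i j) (vtx h (i + k) (j + l)) | i j k l.
     k \<in> {0, 1} \<and> l \<in> {0, 1} \<and> k + l \<noteq> 0}"

definition S31 :: "real \<Rightarrow> (plane \<Rightarrow> real) set" where
  "S31 h = {s. Ck 1 s \<and>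
     (\<forall>i j. (\<exists>p \<in> polys_upto 3. \<forall>x \<in> tri_T h i j. s x = p x) \<and>
            (\<exists>p \<in> polys_upto 3. \<forall>x \<in> tri_T' h i j. s x = p x))}"

definition bary :: "plane \<Rightarrow> plane \<Rightarrow> plane \<Rightarrow> plane \<Rightarrow> real \<times> real \<times> real" where
  "bary w1 w2 w3 x = (THE (t1, t2, t3).
     t1 + t2 + t3 = 1 \<and> x = t1 *\<^sub>R w1 + t2 *\<^sub>R w2 + t3 *\<^sub>R w3)"

definition bernstein3 ::
  "plane \<Rightarrow> plane \<Rightarrow> plane \<Rightarrow> plane \<Rightarrow> nat \<Rightarrow> nat \<Rightarrow> nat \<Rightarrow> real" where
  "bernstein3 w1 w2 w3 x a b c = (case bary w1 w2 w3 x of (t1, t2, t3) \<Rightarrow>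
     fact 3 / (fact a * fact b * fact c) * t1 ^ a * t2 ^ b * t3 ^ c)"


text \<open>
  Masks are vectors indexed by the numeral type 7, whose elements are 0, \<dots>, 6.
\<close>

definition stencil :: "real \<Rightarrow> (plane \<Rightarrow> real) \<Rightarrow> int \<Rightarrow> int \<Rightarrow> real ^ 7" where
  "stencil h g i j = (\<chi> l.
     if l = 0 then g (vtx h i j)
     else if l = 1 then g (vtx h (i + 1) (j + 1))
     else if l = 2 then g (vtx h (i + 1) j)
     else if l = 3 then g (vtx h i (j - 1))
     else if l = 4 then g (vtx h (i - 1) (j - 1))
     else if l = 5 then g (vtx h (i - 1) j)
     else g (vtx h i (j + 1)))"

text \<open>
  A \<open>mask3\<close> holds the masks applied to $f$, $h\,\partial_{1,0} f$ and $h\,\partial_{0,1} f$.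
  Only the six values of \<open>\<beta>\<close> at the pairs $(k,m)$ in $\{-1,0,1\}^2$ with $k+m \neq 0$
  enter the operator.
\<close>

record mask3 =
  m00 :: "real ^ 7"
  m10 :: "real ^ 7"
  m01 :: "real ^ 7"

record masks =
  \<alpha> :: mask3
  \<beta> :: "int \<Rightarrow> int \<Rightarrow> mask3"
  \<gamma> :: mask3
  \<gamma>' :: mask3

definition mask_apply :: "real \<Rightarrow> mask3 \<Rightarrow> (plane \<Rightarrow> real) \<Rightarrow> int \<Rightarrow> int \<Rightarrow> real" where
  "mask_apply h m f i j =
     m00 m \<bullet> stencil h f i j
     + h * (m10 m \<bullet> stencil h (partial_x f) i j)
     + h * (m01 m \<bullet> stencil h (partial_y f) i j)"

definition piece_T :: "real \<Rightarrow> masks \<Rightarrow> (plane \<Rightarrow> real) \<Rightarrow> int \<Rightarrow> int \<Rightarrow> plane \<Rightarrow> real" where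
  "piece_T h M f i j x =
    (let B = bernstein3 (vtx h i j) (vtx h (i + 1) (j + 1)) (vtx h (i + 1) j) x;
         V = mask_apply h (\<alpha> M) f;
         U = (\<lambda>k m. mask_apply h (\<beta> M k m) f);
         C = mask_apply h (\<gamma> M) f
     in V i j * B 3 0 0 + U 1 1 i j * B 2 1 0 + U 1 0 i j * B 2 0 1
        + U (-1) (-1) (i + 1) (j + 1) * B 1 2 0 + C i j * B 1 1 1
        + U (-1) 0 (i + 1) j * B 1 0 2 + V (i + 1) (j + 1) * B 0 3 0
        + U 0 (-1) (i + 1) (j + 1) * B 0 2 1 + U 0 1 (i + 1) j * B 0 1 2
        + V (i + 1) j * B 0 0 3)"

definition piece_T' :: "real \<Rightarrow> masks \<Rightarrow> (plane \<Rightarrow> real) \<Rightarrow> int \<Rightarrow> int \<Rightarrow> plane \<Rightarrow> real" where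
  "piece_T' h M f i j x =
    (let B = bernstein3 (vtx h i (j + 1)) (vtx h (i + 1) (j + 1)) (vtx h i j) x;
         V = mask_apply h (\<alpha> M) f;
         U = (\<lambda>k m. mask_apply h (\<beta> M k m) f);
         C' = mask_apply h (\<gamma>' M) f
     in V i (j + 1) * B 3 0 0 + U 1 0 i (j + 1) * B 2 1 0 + U 0 (-1) i (j + 1) * B 2 0 1
        + U (-1) 0 (i + 1) (j + 1) * B 1 2 0 + C' i j * B 1 1 1
        + U 0 1 i j * B 1 0 2 + V (i + 1) (j + 1) * B 0 3 0
        + U (-1) (-1) (i + 1) (j + 1) * B 0 2 1 + U 1 1 i j * B 0 1 2
        + V i j * B 0 0 3)"

text \<open>
  The description below is proper for every $h > 0$: see \<open>quasi_interp_on_T\<close> and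
  \<open>quasi_interp_on_T'\<close>.
\<close>

definition quasi_interp :: "masks \<Rightarrow> real \<Rightarrow> (plane \<Rightarrow> real) \<Rightarrow> plane \<Rightarrow> real" where
  "quasi_interp M h f = (THE g. \<forall>i j.
     (\<forall>x \<in> tri_T h i j. g x = piece_T h M f i j x) \<and>
     (\<forall>x \<in> tri_T' h i j. g x = piece_T' h M f i j x))"

text \<open>
  The supremum is taken in the extended reals: a real-valued one is unspecified
  if the errors are unbounded.
\<close>

definition error_order_four ::
  "(real \<Rightarrow> (plane \<Rightarrow> real) \<Rightarrow> plane \<Rightarrow> real) \<Rightarrow> (real \<Rightarrow> plane set) \<Rightarrow> bool" where
  "error_order_four Q P \<longleftrightarrow> (\<forall>f. Ck 4 f \<and> bounded_fourth_partials f \<longrightarrow>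
     (\<exists>c. \<forall>\<^sub>F h in at_right 0.
        (SUP q \<in> P h. ereal \<bar>f q - Q h f q\<bar>) \<le> ereal (c * h ^ 4)))"


lemma bary_eqI:
  assumes "\<And>t1 t2 t3. t1 + t2 + t3 = 1 \<and> x = t1 *\<^sub>R w1 + t2 *\<^sub>R w2 + t3 *\<^sub>R w3
    \<longleftrightarrow> (t1, t2, t3) = r"
  shows "bary w1 w2 w3 x = r"
  unfolding bary_def by (rule the_equality) (use assms in auto)

lemma weights_sum: "a + (b + c) = 1 \<Longrightarrow> a * k + (b * k + c * k) = k" for a b c k :: real
  by (metis distrib_right mult_1)

lemma tri_coords:
  fixes h s t :: real and i j i' j' i'' j'' :: int
  assumes "h > 0"
  shows "(h * (s + t), h * (s - t)) =
      t1 *\<^sub>R vtx h i j + t2 *\<^sub>R vtx h i' j' + t3 *\<^sub>R vtx h i'' j''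
    \<longleftrightarrow> s = t1 * i + t2 * i' + t3 * i'' \<and> t = t1 * j + t2 * j' + t3 * j''"
proof -
  have "t1 *\<^sub>R vtx h i j + t2 *\<^sub>R vtx h i' j' + t3 *\<^sub>R vtx h i'' j''
    = (h * ((t1 * i + t2 * i' + t3 * i'') + (t1 * j + t2 * j' + t3 * j'')),
       h * ((t1 * i + t2 * i' + t3 * i'') - (t1 * j + t2 * j' + t3 * j'')))"
    by (simp add: vtx_def algebra_simps)
  then show ?thesis using assms by (simp del: distrib_left) argo
qed

lemma bary_T:
  fixes h s t :: real and i j :: int
  assumes "h > 0"
  shows "bary (vtx h i j) (vtx h (i + 1) (j + 1)) (vtx h (i + 1) j) (h * (s + t), h * (s - t)) =
    (1 - (s - i), t - j, (s - i) - (t - j))"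
proof (rule bary_eqI, unfold tri_coords[OF assms])
  fix t1 t2 t3 :: real
  have "t1 + t2 + t3 = 1 \<Longrightarrow> t1 * i + t2 * (i + 1) + t3 * (i + 1) = i + t2 + t3
    \<and> t1 * j + t2 * (j + 1) + t3 * j = j + t2"
    by (simp add: algebra_simps weights_sum)
  then show "t1 + t2 + t3 = 1 \<and> s = t1 * i + t2 * of_int (i + 1) + t3 * of_int (i + 1)
      \<and> t = t1 * j + t2 * of_int (j + 1) + t3 * j
    \<longleftrightarrow> (t1, t2, t3) = (1 - (s - i), t - j, (s - i) - (t - j))"
    by (cases "t1 + t2 + t3 = 1") auto
qed

lemma bary_T':
  fixes h s t :: real and i j :: int
  assumes "h > 0"
  shows "bary (vtx h i (j + 1)) (vtx h (i + 1) (j + 1)) (vtx h i j) (h * (s + t), h * (s - t)) =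
    ((t - j) - (s - i), s - i, 1 - (t - j))"
proof (rule bary_eqI, unfold tri_coords[OF assms])
  fix t1 t2 t3 :: real
  have "t1 + t2 + t3 = 1 \<Longrightarrow> t1 * i + t2 * (i + 1) + t3 * i = i + t2
    \<and> t1 * (j + 1) + t2 * (j + 1) + t3 * j = j + t1 + t2"
    by (simp add: algebra_simps weights_sum)
  then show "t1 + t2 + t3 = 1 \<and> s = t1 * i + t2 * of_int (i + 1) + t3 * i
      \<and> t = t1 * of_int (j + 1) + t2 * of_int (j + 1) + t3 * j
    \<longleftrightarrow> (t1, t2, t3) = ((t - j) - (s - i), s - i, 1 - (t - j))"
    by (cases "t1 + t2 + t3 = 1") auto
qed

lemma mem_tri_T:
  fixes h s t :: real and i j :: int
  assumes "h > 0"
  shows "(h * (s + t), h * (s - t)) \<in> tri_T h i j \<longleftrightarrow> j \<le> t \<and> t - j \<le> s - i \<and> s \<le> i + 1"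
proof
  assume "(h * (s + t), h * (s - t)) \<in> tri_T h i j"
  then obtain a b c :: real where "a \<ge> 0" "b \<ge> 0" "c \<ge> 0" and abc: "a + b + c = 1"
    and st: "s = a * i + b * of_int (i + 1) + c * of_int (i + 1)"
      "t = a * j + b * of_int (j + 1) + c * j"
    unfolding tri_T_def convex_hull_3 by (auto simp: tri_coords[OF assms])
  moreover have "s = i + b + c" "t = j + b"
    using abc weights_sum[of a b c i] weights_sum[of a b c j] unfolding st
    by (simp_all add: algebra_simps)
  ultimately show "j \<le> t \<and> t - j \<le> s - i \<and> s \<le> i + 1" by linarith
next
  assume st: "j \<le> t \<and> t - j \<le> s - i \<and> s \<le> i + 1"
  have "(h * (s + t), h * (s - t)) = (1 - (s - i)) *\<^sub>R vtx h i j
    + (t - j) *\<^sub>R vtx h (i + 1) (j + 1) + ((s - i) - (t - j)) *\<^sub>R vtx h (i + 1) j"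
    by (subst tri_coords[OF assms]) (simp add: algebra_simps)
  then show "(h * (s + t), h * (s - t)) \<in> tri_T h i j"
    unfolding tri_T_def convex_hull_3 using st
    by (intro CollectI exI[of _ "1 - (s - i)"] exI[of _ "t - j"] exI[of _ "(s - i) - (t - j)"]) simp
qed

lemma mem_tri_T':
  fixes h s t :: real and i j :: int
  assumes "h > 0"
  shows "(h * (s + t), h * (s - t)) \<in> tri_T' h i j \<longleftrightarrow> i \<le> s \<and> s - i \<le> t - j \<and> t \<le> j + 1"
proof
  assume "(h * (s + t), h * (s - t)) \<in> tri_T' h i j"
  then obtain a b c :: real where "a \<ge> 0" "b \<ge> 0" "c \<ge> 0" and abc: "a + b + c = 1"
    and st: "s = a * i + b * of_int (i + 1) + c * i"
      "t = a * j + b * of_int (j + 1) + c * of_int (j + 1)"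
    unfolding tri_T'_def convex_hull_3 by (auto simp: tri_coords[OF assms])
  moreover have "s = i + b" "t = j + b + c"
    using abc weights_sum[of a b c i] weights_sum[of a b c j] unfolding st
    by (simp_all add: algebra_simps)
  ultimately show "i \<le> s \<and> s - i \<le> t - j \<and> t \<le> j + 1" by linarith
next
  assume st: "i \<le> s \<and> s - i \<le> t - j \<and> t \<le> j + 1"
  have "(h * (s + t), h * (s - t)) = (1 - (t - j)) *\<^sub>R vtx h i j
    + (s - i) *\<^sub>R vtx h (i + 1) (j + 1) + ((t - j) - (s - i)) *\<^sub>R vtx h i (j + 1)"
    by (subst tri_coords[OF assms]) (simp add: algebra_simps)
  then show "(h * (s + t), h * (s - t)) \<in> tri_T' h i j"
    unfolding tri_T'_def convex_hull_3 using st
    by (intro CollectI exI[of _ "1 - (t - j)"] exI[of _ "s - i"] exI[of _ "(t - j) - (s - i)"]) simp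
qed

lemma plane_coords:
  fixes x :: plane
  assumes "h > 0"
  obtains s t :: real where "x = (h * (s + t), h * (s - t))"
proof
  show "x = (h * ((fst x + snd x) / (2 * h) + (fst x - snd x) / (2 * h)),
             h * ((fst x + snd x) / (2 * h) - (fst x - snd x) / (2 * h)))"
    using assms by (simp add: prod_eq_iff field_simps)
qed

lemma pieces_diag:
  fixes h s t :: real and i j :: int
  assumes "h > 0" "s - i = t - j"
  shows "piece_T h M f i j (h * (s + t), h * (s - t)) = piece_T' h M f i j (h * (s + t), h * (s - t))"
  unfolding piece_T_def piece_T'_def bernstein3_def Let_def
    bary_T[OF assms(1)] bary_T'[OF assms(1)] prod.case
  using assms(2) by (simp add: mult_ac)

lemma pieces_right:
  fixes h s t :: real and i j :: int
  assumes "h > 0" "s = of_int i + 1"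
  shows "piece_T h M f i j (h * (s + t), h * (s - t)) = piece_T' h M f (i + 1) j (h * (s + t), h * (s - t))"
  unfolding piece_T_def piece_T'_def bernstein3_def Let_def
    bary_T[OF assms(1)] bary_T'[OF assms(1)] prod.case
  using assms(2) by simp

lemma pieces_bottom:
  fixes h s t :: real and i j :: int
  assumes "h > 0" "t = of_int j + 1"
  shows "piece_T' h M f i j (h * (s + t), h * (s - t)) = piece_T h M f i (j + 1) (h * (s + t), h * (s - t))"
  unfolding piece_T_def piece_T'_def bernstein3_def Let_def
    bary_T[OF assms(1)] bary_T'[OF assms(1)] prod.case
  using assms(2) by simp

lemma quasi_interp_pieces:
  assumes h: "h > 0"
  shows "\<forall>i j. (\<forall>x \<in> tri_T h i j. quasi_interp M h f x = piece_T h M f i j x) \<and>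
    (\<forall>x \<in> tri_T' h i j. quasi_interp M h f x = piece_T' h M f i j x)"
  (is "?P (quasi_interp M h f)")
proof -
  define S T where "S = (\<lambda>x :: plane. (fst x + snd x) / (2 * h))"
    and "T = (\<lambda>x :: plane. (fst x - snd x) / (2 * h))"
  have ST: "S (h * (s + t), h * (s - t)) = s" "T (h * (s + t), h * (s - t)) = t" for s t :: real
    using h by (auto simp: S_def T_def field_simps)
  define g where "g = (\<lambda>x. if T x - \<lfloor>T x\<rfloor> \<le> S x - \<lfloor>S x\<rfloor>
    then piece_T h M f \<lfloor>S x\<rfloor> \<lfloor>T x\<rfloor> x else piece_T' h M f \<lfloor>S x\<rfloor> \<lfloor>T x\<rfloor> x)"
  have g_eq: "g (h * (s + t), h * (s - t)) = (if t - \<lfloor>t\<rfloor> \<le> s - \<lfloor>s\<rfloor>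
    then piece_T h M f \<lfloor>s\<rfloor> \<lfloor>t\<rfloor> (h * (s + t), h * (s - t))
    else piece_T' h M f \<lfloor>s\<rfloor> \<lfloor>t\<rfloor> (h * (s + t), h * (s - t)))" for s t :: real
    unfolding g_def ST ..
  have gT: "g x = piece_T h M f i j x" if x: "x \<in> tri_T h i j" for i j x
  proof -
    obtain s t where x_eq: "x = (h * (s + t), h * (s - t))" using plane_coords[OF h] .
    have st: "j \<le> t" "t - j \<le> s - i" "s \<le> i + 1" using x mem_tri_T[OF h] x_eq by auto
    consider "s < i + 1" | "s = i + 1" "t < j + 1" | "s = i + 1" "t = j + 1" using st by linarith
    then show ?thesis
    proof cases
      case 1
      then have "\<lfloor>s\<rfloor> = i" "\<lfloor>t\<rfloor> = j" using st by linarith+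
      then show ?thesis using st by (simp add: g_def x_eq ST)
    next
      case 2
      then have fl: "\<lfloor>s\<rfloor> = i + 1" "\<lfloor>t\<rfloor> = j" using st by linarith+
      have "g x = piece_T' h M f (i + 1) j x"
        using st 2 fl pieces_diag[OF h, of s "i + 1" t j] by (auto simp: g_def x_eq ST)
      then show ?thesis using pieces_right[OF h] 2 by (simp add: x_eq)
    next
      case 3
      then have fl: "\<lfloor>s\<rfloor> = i + 1" "\<lfloor>t\<rfloor> = j + 1" by linarith+
      have "g x = piece_T h M f (i + 1) (j + 1) x"
        unfolding x_eq g_eq fl using 3 by simp
      also have "\<dots> = piece_T' h M f (i + 1) j x"
        unfolding x_eq by (rule pieces_bottom[symmetric]) (use h 3 in auto)
      also have "\<dots> = piece_T h M f i j x"
        unfolding x_eq by (rule pieces_right[symmetric]) (use h 3 in auto)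
      finally show ?thesis .
    qed
  qed
  have gT': "g x = piece_T' h M f i j x" if x: "x \<in> tri_T' h i j" for i j x
  proof -
    obtain s t where x_eq: "x = (h * (s + t), h * (s - t))" using plane_coords[OF h] .
    have st: "i \<le> s" "s - i \<le> t - j" "t \<le> j + 1" using x mem_tri_T'[OF h] x_eq by auto
    consider "t < j + 1" | "t = j + 1" using st by linarith
    then show ?thesis
    proof cases
      case 1
      then have fl: "\<lfloor>s\<rfloor> = i" "\<lfloor>t\<rfloor> = j" using st by linarith+
      show ?thesis
      proof (cases "s - i = t - j")
        case True
        then show ?thesis using fl pieces_diag[OF h True] by (simp add: g_def x_eq ST)
      next
        case False
        then show ?thesis using fl st by (simp add: g_def x_eq ST)
      qed
    next
      case 2
      have "x \<in> tri_T h i (j + 1)" using st 2 by (simp add: mem_tri_T[OF h] x_eq)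
      then have "g x = piece_T h M f i (j + 1) x" by (rule gT)
      then show ?thesis unfolding x_eq using pieces_bottom[OF h, of t j] 2 by simp
    qed
  qed
  have Pg: "?P g" using gT gT' by blast
  have "g' = g" if "?P g'" for g'
  proof
    fix x
    obtain s t where x_eq: "x = (h * (s + t), h * (s - t))" using plane_coords[OF h] .
    have "x \<in> tri_T h \<lfloor>s\<rfloor> \<lfloor>t\<rfloor> \<or> x \<in> tri_T' h \<lfloor>s\<rfloor> \<lfloor>t\<rfloor>"
      unfolding x_eq mem_tri_T[OF h] mem_tri_T'[OF h] by linarith
    then show "g' x = g x" using that Pg by metis
  qed
  with Pg have "quasi_interp M h f = g" unfolding quasi_interp_def by (intro the_equality)
  then show ?thesis using Pg by simp
qed

lemma quasi_interp_on_T: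
  "h > 0 \<Longrightarrow> x \<in> tri_T h i j \<Longrightarrow> quasi_interp M h f x = piece_T h M f i j x"
  using quasi_interp_pieces by blast

lemma quasi_interp_on_T':
  "h > 0 \<Longrightarrow> x \<in> tri_T' h i j \<Longrightarrow> quasi_interp M h f x = piece_T' h M f i j x"
  using quasi_interp_pieces by blast

end

theory Submission
  imports Defs
begin

text \<open>
  Let $V$ and $U^{k,m}$ be the functionals that produce the Bernstein coefficients at a vertex and, in direction
  $(k,m)$, next to it, and let $e$ be the vector from a vertex to a neighbour. The theorem has an analytic half and an algebraic half,
  and they meet in one condition: the vertex functional $V$ reproduces all cubics.

  \<^bold>\<open>Analysis.\<close> Continuity of the derivatives across the sides forces $U^{k,m} + U^{-k,-m} = 2V$
  (\<open>opposite_sum\<close>), and exactness on quadratics makes $V$ and $U^{k,m}$ exact on quadratics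
  (\<open>vertex_exact\<close>, \<open>edge_exact\<close>). If $p$ is cubic, then $p(\cdot + e) - p$ is
  quadratic, so the defects of $V$ and of $U^{k,m}$ on $p$ are the same at all vertices. Along a side the
  spline is a cubic Hermite interpolant with constant defects in its data; the defects in the slopes cancel at
  the midpoint, and since cubic Hermite interpolation is exact on cubics, the error at the midpoint is the
  defect of $V$ (\<open>midpoint_error_cubic\<close>). On a homogeneous cubic this defect is a constant times
  $h^3$, so order four forces it to vanish (\<open>exact_cubic_if_order_four\<close>). Conversely, if it vanishes
  on all cubics, then a Taylor expansion of $f$ at a vertex leaves a remainder of size $h^4$, to which the
  masks apply boundedly (\<open>order_four_if_exact_cubic\<close>).

  \<^bold>\<open>Algebra.\<close> Function values and gradients at the lattice points are independent of each
  other, so the smoothness relations can be tested on functions that carry a single unit datum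
  (\<open>mask_entry_test_function\<close>). This turns them into linear equations for the entries of the masks.
  Entries outside the seven point stencil vanish, and this makes the equations rigid: for each of the three kinds
  of data, $\alpha$ is determined by four of its entries (\<open>hexagon_system\<close>, \<open>mask_structure\<close>).
  On the twelve remaining unknowns, exactness on quadratics imposes seven independent conditions and the four
  cubic monomials impose four more. The solution set is the line parametrised by $\lambda$
  (\<open>cubic_exactness_iff\<close>).
\<close>

section \<open>Stencils, partial derivatives and masks\<close>

lemma UNIV_7: "(UNIV :: 7 set) = {0, 1, 2, 3, 4, 5, 6}"
proof -
  have "x \<in> {0, 1, 2, 3, 4, 5, 6}" for x :: 7
  proof (induct x)
    case (of_int z)
    then have "z = 0 \<or> z = 1 \<or> z = 2 \<or> z = 3 \<or> z = 4 \<or> z = 5 \<or> z = 6" by fastforce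
    then show ?case by auto
  qed
  then show ?thesis by auto
qed

lemma sum_7: "sum f (UNIV :: 7 set) = f 0 + f 1 + f 2 + f 3 + f 4 + f 5 + f 6"
  for f :: "7 \<Rightarrow> real"
  unfolding UNIV_7 by simp

lemma inner_stencil:
  "m \<bullet> stencil h g i j =
     m $ 0 * g (vtx h i j) + m $ 1 * g (vtx h (i + 1) (j + 1)) + m $ 2 * g (vtx h (i + 1) j)
   + m $ 3 * g (vtx h i (j - 1)) + m $ 4 * g (vtx h (i - 1) (j - 1))
   + m $ 5 * g (vtx h (i - 1) j) + m $ 6 * g (vtx h i (j + 1))"
  by (simp add: inner_vec_def sum_7 stencil_def)

text \<open>
  The part of \<open>Ck 1\<close> that makes \<open>partial_x\<close> and \<open>partial_y\<close> linear and
  compatible with affine substitutions.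
\<close>
definition partially_differentiable :: "(plane \<Rightarrow> real) \<Rightarrow> bool" where
  "partially_differentiable f \<longleftrightarrow>
     (\<forall>x y. (\<lambda>t. f (t, y)) differentiable (at x) \<and> (\<lambda>t. f (x, t)) differentiable (at y))"

lemma Ck_Suc_iff:
  "Ck (Suc k) f \<longleftrightarrow> continuous_on UNIV f \<and> partially_differentiable f
     \<and> Ck k (partial_x f) \<and> Ck k (partial_y f)"
  by (simp add: partially_differentiable_def)

lemma Ck_1_partially_differentiable: "Ck 1 f \<Longrightarrow> partially_differentiable f"
  by (simp add: partially_differentiable_def)

lemma has_partial_x:
  "partially_differentiable f \<Longrightarrow> ((\<lambda>t. f (t, y)) has_real_derivative partial_x f (x, y)) (at x)"
  unfolding partial_x_def partially_differentiable_def
  by (simp add: DERIV_deriv_iff_real_differentiable)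

lemma has_partial_y:
  "partially_differentiable f \<Longrightarrow> ((\<lambda>t. f (x, t)) has_real_derivative partial_y f (x, y)) (at y)"
  unfolding partial_y_def partially_differentiable_def
  by (simp add: DERIV_deriv_iff_real_differentiable)

lemma partials_eqI:
  assumes "\<And>x y. ((\<lambda>t. f (t, y)) has_real_derivative fx (x, y)) (at x)"
    and "\<And>x y. ((\<lambda>t. f (x, t)) has_real_derivative fy (x, y)) (at y)"
  shows "partially_differentiable f" "partial_x f = fx" "partial_y f = fy"
proof -
  show "partially_differentiable f"
    unfolding partially_differentiable_def real_differentiable_def using assms by blast
  show "partial_x f = fx" "partial_y f = fy"
    using DERIV_imp_deriv[OF assms(1)] DERIV_imp_deriv[OF assms(2)]
    by (simp_all add: partial_x_def partial_y_def fun_eq_iff)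
qed

lemma partials_lincomb:
  assumes "partially_differentiable f" "partially_differentiable g"
  shows "partially_differentiable (\<lambda>z. a * f z + b * g z)"
    and "partial_x (\<lambda>z. a * f z + b * g z) = (\<lambda>z. a * partial_x f z + b * partial_x g z)"
    and "partial_y (\<lambda>z. a * f z + b * g z) = (\<lambda>z. a * partial_y f z + b * partial_y g z)"
proof -
  have *: "((\<lambda>t. a * f (t, y) + b * g (t, y)) has_real_derivative
      a * partial_x f (x, y) + b * partial_x g (x, y)) (at x)"
    "((\<lambda>t. a * f (x, t) + b * g (x, t)) has_real_derivative
      a * partial_y f (x, y) + b * partial_y g (x, y)) (at y)" for x y
    by (rule derivative_eq_intros has_partial_x[OF assms(1)] has_partial_x[OF assms(2)]
        has_partial_y[OF assms(1)] has_partial_y[OF assms(2)] refl | simp)+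
  from partials_eqI[of "\<lambda>z. a * f z + b * g z" "\<lambda>z. a * partial_x f z + b * partial_x g z"
      "\<lambda>z. a * partial_y f z + b * partial_y g z", OF *]
  show "partially_differentiable (\<lambda>z. a * f z + b * g z)"
    and "partial_x (\<lambda>z. a * f z + b * g z) = (\<lambda>z. a * partial_x f z + b * partial_x g z)"
    and "partial_y (\<lambda>z. a * f z + b * g z) = (\<lambda>z. a * partial_y f z + b * partial_y g z)" .
qed

lemma Ck_lincomb:
  "Ck k f \<Longrightarrow> Ck k g \<Longrightarrow> Ck k (\<lambda>z. a * f z + b * g z)"
proof (induction k arbitrary: f g)
  case 0
  then show ?case by (auto intro!: continuous_intros)
next
  case (Suc k)
  then show ?case unfolding Ck_Suc_iff
    by (auto simp: partials_lincomb intro!: continuous_intros)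
qed

lemma vtx_add: "vtx h (i + k) (j + l) = vtx h i j + h *\<^sub>R vtx 1 k l"
  by (simp add: vtx_def algebra_simps)

lemma vtx_0: "vtx h 0 0 = 0"
  by (simp add: vtx_def zero_prod_def)

lemma partials_affine:
  assumes "partially_differentiable f"
  shows "partially_differentiable (\<lambda>z. f (v + h *\<^sub>R z))"
    and "partial_x (\<lambda>z. f (v + h *\<^sub>R z)) = (\<lambda>z. h * partial_x f (v + h *\<^sub>R z))"
    and "partial_y (\<lambda>z. f (v + h *\<^sub>R z)) = (\<lambda>z. h * partial_y f (v + h *\<^sub>R z))"
proof -
  obtain a b where v: "v = (a, b)" by fastforce
  have X: "((\<lambda>t. f (a + h * t, b + h * y)) has_real_derivative
      partial_x f (a + h * x, b + h * y) * h) (at x)" for x y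
    by (rule DERIV_chain'[OF _ has_partial_x[OF assms], of "\<lambda>t. a + h * t"])
      (auto intro!: derivative_eq_intros)
  have Y: "((\<lambda>t. f (a + h * x, b + h * t)) has_real_derivative
      partial_y f (a + h * x, b + h * y) * h) (at y)" for x y
    by (rule DERIV_chain'[OF _ has_partial_y[OF assms], of "\<lambda>t. b + h * t"])
      (auto intro!: derivative_eq_intros)
  show "partially_differentiable (\<lambda>z. f (v + h *\<^sub>R z))"
    and "partial_x (\<lambda>z. f (v + h *\<^sub>R z)) = (\<lambda>z. h * partial_x f (v + h *\<^sub>R z))"
    and "partial_y (\<lambda>z. f (v + h *\<^sub>R z)) = (\<lambda>z. h * partial_y f (v + h *\<^sub>R z))"
    using partials_eqI[of "\<lambda>z. f (v + h *\<^sub>R z)" "\<lambda>z. h * partial_x f (v + h *\<^sub>R z)"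
        "\<lambda>z. h * partial_y f (v + h *\<^sub>R z)"] X Y by (simp_all add: v mult.commute)
qed

lemma mask_apply_lincomb:
  assumes "partially_differentiable f" "partially_differentiable g"
  shows "mask_apply h m (\<lambda>z. a * f z + b * g z) i j
    = a * mask_apply h m f i j + b * mask_apply h m g i j"
  unfolding mask_apply_def partials_lincomb[OF assms] inner_stencil
  by (simp add: algebra_simps)

text \<open>
  Derivatives enter the masks multiplied by $h$. This makes them invariant under dilations, so
  every mask may be evaluated at the origin of the lattice with $h = 1$.
\<close>
lemma mask_apply_to_unit:
  assumes "partially_differentiable f"
  shows "mask_apply h m f i j = mask_apply 1 m (\<lambda>z. f (vtx h i j + h *\<^sub>R z)) 0 0"
proof -
  have "stencil h g i j = stencil 1 (\<lambda>z. g (vtx h i j + h *\<^sub>R z)) 0 0" for g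
    using vtx_add[of h i 0 j "-1"] vtx_add[of h i 0 j 1]
      vtx_add[of h i "-1" j 0] vtx_add[of h i "-1" j "-1"] vtx_add[of h i 1 j 0] vtx_add[of h i 1 j 1]
    by (simp add: stencil_def vec_eq_iff vtx_0)
  moreover have "stencil 1 (\<lambda>z. h * g z) 0 0 = h *\<^sub>R stencil 1 g 0 0" for g
    by (simp add: stencil_def vec_eq_iff)
  ultimately show ?thesis
    unfolding mask_apply_def partials_affine[OF assms] by simp
qed

lemma mask_apply_shift:
  assumes "partially_differentiable f"
  shows "mask_apply h m f (i + k) (j + l) = mask_apply h m (\<lambda>z. f (z + vtx h k l)) i j"
proof -
  have 1: "partially_differentiable (\<lambda>z. f (z + vtx h k l))"
    using partials_affine(1)[OF assms, of "vtx h k l" 1] by (simp add: add.commute)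
  have "vtx h (i + k) (j + l) + h *\<^sub>R z = vtx h i j + h *\<^sub>R z + vtx h k l" for z
    by (simp add: vtx_def algebra_simps)
  then show ?thesis
    by (simp only: mask_apply_to_unit[OF assms] mask_apply_to_unit[OF 1])
qed

lemma inner_bound:
  fixes m v :: "real ^ 'n"
  assumes "\<And>l. \<bar>v $ l\<bar> \<le> B"
  shows "\<bar>m \<bullet> v\<bar> \<le> (\<Sum>l\<in>UNIV. \<bar>m $ l\<bar>) * B"
proof -
  have "\<bar>m \<bullet> v\<bar> \<le> (\<Sum>l\<in>UNIV. \<bar>m $ l * v $ l\<bar>)"
    unfolding inner_vec_def by simp
  also have "\<dots> \<le> (\<Sum>l\<in>UNIV. \<bar>m $ l\<bar> * B)"
    by (intro sum_mono) (auto simp: abs_mult intro!: mult_left_mono assms)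
  finally show ?thesis by (simp add: sum_distrib_right)
qed

text \<open>
  The operator norm of a mask with respect to the supremum of the data $f$, $h\,\partial_{1,0}f$ and
  $h\,\partial_{0,1}f$ on the stencil.
\<close>
definition mask_norm :: "mask3 \<Rightarrow> real" where
  "mask_norm m = (\<Sum>l\<in>UNIV. \<bar>m00 m $ l\<bar>) + (\<Sum>l\<in>UNIV. \<bar>m10 m $ l\<bar>) + (\<Sum>l\<in>UNIV. \<bar>m01 m $ l\<bar>)"

lemma mask_norm_nonneg: "mask_norm m \<ge> 0"
  unfolding mask_norm_def by (intro add_nonneg_nonneg sum_nonneg) auto

lemma mask_apply_bound:
  assumes "h > 0"
    and "\<And>k l. \<bar>k\<bar> \<le> 1 \<Longrightarrow> \<bar>l\<bar> \<le> 1 \<Longrightarrow> \<bar>f (vtx h (i + k) (j + l))\<bar> \<le> B"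
    and "\<And>k l. \<bar>k\<bar> \<le> 1 \<Longrightarrow> \<bar>l\<bar> \<le> 1 \<Longrightarrow> \<bar>h * partial_x f (vtx h (i + k) (j + l))\<bar> \<le> B"
    and "\<And>k l. \<bar>k\<bar> \<le> 1 \<Longrightarrow> \<bar>l\<bar> \<le> 1 \<Longrightarrow> \<bar>h * partial_y f (vtx h (i + k) (j + l))\<bar> \<le> B"
  shows "\<bar>mask_apply h m f i j\<bar> \<le> mask_norm m * B"
proof -
  have st: "\<bar>stencil h g i j $ l\<bar> \<le> B"
    if "\<And>k l. \<bar>k\<bar> \<le> 1 \<Longrightarrow> \<bar>l\<bar> \<le> 1 \<Longrightarrow> \<bar>g (vtx h (i + k) (j + l))\<bar> \<le> B" for g l
    using that[of 0 0] that[of 1 1] that[of 1 0] that[of 0 "-1"] that[of "-1" "-1"] that[of "-1" 0]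
      that[of 0 1] by (simp add: stencil_def)
  have scale: "h * (m' \<bullet> stencil h g i j) = m' \<bullet> stencil h (\<lambda>z. h * g z) i j" for m' g
    by (simp add: inner_stencil algebra_simps)
  have "\<bar>m00 m \<bullet> stencil h f i j\<bar> \<le> (\<Sum>l\<in>UNIV. \<bar>m00 m $ l\<bar>) * B"
    and "\<bar>h * (m10 m \<bullet> stencil h (partial_x f) i j)\<bar> \<le> (\<Sum>l\<in>UNIV. \<bar>m10 m $ l\<bar>) * B"
    and "\<bar>h * (m01 m \<bullet> stencil h (partial_y f) i j)\<bar> \<le> (\<Sum>l\<in>UNIV. \<bar>m01 m $ l\<bar>) * B"
    unfolding scale by (intro inner_bound st assms; assumption)+
  then show ?thesis
    unfolding mask_apply_def mask_norm_def distrib_right by linarith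
qed

section \<open>Quadratic and cubic polynomials\<close>

lemma polys_upto_2_iff:
  "p \<in> polys_upto 2 \<longleftrightarrow> (\<exists>c00 c10 c01 c20 c11 c02. \<forall>x y.
     p (x, y) = c00 + c10 * x + c01 * y + c20 * x\<^sup>2 + c11 * x * y + c02 * y\<^sup>2)"
proof
  assume "p \<in> polys_upto 2"
  then obtain c where c: "\<And>x y. p (x, y) = (\<Sum>a\<le>2. \<Sum>b\<le>2 - a. c a b * x ^ a * y ^ b)"
    unfolding polys_upto_def by blast
  show "\<exists>c00 c10 c01 c20 c11 c02. \<forall>x y.
     p (x, y) = c00 + c10 * x + c01 * y + c20 * x\<^sup>2 + c11 * x * y + c02 * y\<^sup>2"
    by (rule exI[of _ "c 0 0"], rule exI[of _ "c 1 0"], rule exI[of _ "c 0 1"],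
      rule exI[of _ "c 2 0"], rule exI[of _ "c 1 1"], rule exI[of _ "c 0 2"])
      (simp add: c numeral_2_eq_2)
next
  assume "\<exists>c00 c10 c01 c20 c11 c02. \<forall>x y.
     p (x, y) = c00 + c10 * x + c01 * y + c20 * x\<^sup>2 + c11 * x * y + c02 * y\<^sup>2"
  then obtain c00 c10 c01 c20 c11 c02 where c:
    "\<And>x y. p (x, y) = c00 + c10 * x + c01 * y + c20 * x\<^sup>2 + c11 * x * y + c02 * y\<^sup>2" by blast
  have "p (x, y) = (\<Sum>a\<le>2. \<Sum>b\<le>2 - a.
      ([[c00, c01, c02], [c10, c11], [c20]] ! a ! b) * x ^ a * y ^ b)" for x y
    by (simp add: c numeral_2_eq_2)
  then show "p \<in> polys_upto 2" unfolding polys_upto_def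
    by (intro CollectI exI[of _ "\<lambda>a b. [[c00, c01, c02], [c10, c11], [c20]] ! a ! b"] allI)
qed

lemma polys_upto_3_iff:
  "p \<in> polys_upto 3 \<longleftrightarrow> (\<exists>q \<in> polys_upto 2. \<exists>c30 c21 c12 c03. \<forall>x y.
     p (x, y) = q (x, y) + c30 * x ^ 3 + c21 * x\<^sup>2 * y + c12 * x * y\<^sup>2 + c03 * y ^ 3)"
proof
  assume "p \<in> polys_upto 3"
  then obtain c where c: "\<And>x y. p (x, y) = (\<Sum>a\<le>3. \<Sum>b\<le>3 - a. c a b * x ^ a * y ^ b)"
    unfolding polys_upto_def by blast
  have "(\<lambda>(x, y). (\<Sum>a\<le>2. \<Sum>b\<le>2 - a. c a b * x ^ a * y ^ b)) \<in> polys_upto 2"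
    unfolding polys_upto_def by auto
  moreover have "p (x, y) = (\<lambda>(x, y). (\<Sum>a\<le>2. \<Sum>b\<le>2 - a. c a b * x ^ a * y ^ b)) (x, y)
     + c 3 0 * x ^ 3 + c 2 1 * x\<^sup>2 * y + c 1 2 * x * y\<^sup>2 + c 0 3 * y ^ 3" for x y
    by (simp add: c numeral_2_eq_2 numeral_3_eq_3)
  ultimately show "\<exists>q \<in> polys_upto 2. \<exists>c30 c21 c12 c03. \<forall>x y.
     p (x, y) = q (x, y) + c30 * x ^ 3 + c21 * x\<^sup>2 * y + c12 * x * y\<^sup>2 + c03 * y ^ 3"
    by blast
next
  assume "\<exists>q \<in> polys_upto 2. \<exists>c30 c21 c12 c03. \<forall>x y.
     p (x, y) = q (x, y) + c30 * x ^ 3 + c21 * x\<^sup>2 * y + c12 * x * y\<^sup>2 + c03 * y ^ 3"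
  then obtain q c30 c21 c12 c03 where q: "q \<in> polys_upto 2" and p: "\<forall>x y.
     p (x, y) = q (x, y) + c30 * x ^ 3 + c21 * x\<^sup>2 * y + c12 * x * y\<^sup>2 + c03 * y ^ 3" by blast
  from q obtain c00 c10 c01 c20 c11 c02 where
    "\<forall>x y. q (x, y) = c00 + c10 * x + c01 * y + c20 * x\<^sup>2 + c11 * x * y + c02 * y\<^sup>2"
    unfolding polys_upto_2_iff by blast
  with p have c: "p (x, y) = c00 + c10 * x + c01 * y + c20 * x\<^sup>2 + c11 * x * y + c02 * y\<^sup>2
      + c30 * x ^ 3 + c21 * x\<^sup>2 * y + c12 * x * y\<^sup>2 + c03 * y ^ 3" for x y by simp
  have "p (x, y) = (\<Sum>a\<le>3. \<Sum>b\<le>3 - a.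
      ([[c00, c01, c02, c03], [c10, c11, c12], [c20, c21], [c30]] ! a ! b) * x ^ a * y ^ b)" for x y
    by (simp add: c numeral_2_eq_2 numeral_3_eq_3)
  then show "p \<in> polys_upto 3" unfolding polys_upto_def
    by (intro CollectI allI
      exI[of _ "\<lambda>a b. [[c00, c01, c02, c03], [c10, c11, c12], [c20, c21], [c30]] ! a ! b"])
qed

lemma polys_upto_mono: "p \<in> polys_upto 2 \<Longrightarrow> p \<in> polys_upto 3"
  unfolding polys_upto_3_iff by (rule bexI[of _ p]) (auto intro!: exI[of _ 0])

definition monom2 :: "nat \<Rightarrow> nat \<Rightarrow> plane \<Rightarrow> real" where
  "monom2 a b = (\<lambda>(x, y). x ^ a * y ^ b)"

lemma partials_monom2:
  "partially_differentiable (monom2 a b)"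
  "partial_x (monom2 a b) = (\<lambda>z. a * monom2 (a - 1) b z)"
  "partial_y (monom2 a b) = (\<lambda>z. b * monom2 a (b - 1) z)"
proof -
  have "((\<lambda>t. monom2 a b (t, y)) has_real_derivative a * monom2 (a - 1) b (x, y)) (at x)"
    "((\<lambda>t. monom2 a b (x, t)) has_real_derivative b * monom2 a (b - 1) (x, y)) (at y)" for x y
    unfolding monom2_def prod.case by (auto intro!: derivative_eq_intros)
  from partials_eqI[of "monom2 a b" "\<lambda>z. a * monom2 (a - 1) b z" "\<lambda>z. b * monom2 a (b - 1) z", OF this]
  show "partially_differentiable (monom2 a b)"
    "partial_x (monom2 a b) = (\<lambda>z. a * monom2 (a - 1) b z)"
    "partial_y (monom2 a b) = (\<lambda>z. b * monom2 a (b - 1) z)" by auto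
qed

lemma continuous_on_monom2: "continuous_on UNIV (monom2 a b)"
  unfolding monom2_def by (auto intro!: continuous_intros simp: case_prod_unfold)

lemma Ck_monom2: "Ck k (monom2 a b)"
proof (induction k arbitrary: a b)
  case (Suc k)
  have "Ck k (\<lambda>z. c * monom2 a b z)" for c a b
    using Ck_lincomb[OF Suc Suc, of c a b 0 a b] by simp
  then show ?case unfolding Ck_Suc_iff by (simp add: partials_monom2 continuous_on_monom2)
qed (simp add: continuous_on_monom2)

text \<open>
  The nested combinations with unit coefficients have the shape to which the two term rules
  \<open>Ck_lincomb\<close> and \<open>mask_apply_lincomb\<close> apply by rewriting.
\<close>
lemma polys_upto_3_monom:
  assumes "p \<in> polys_upto 3"
  obtains q c30 c21 c12 c03 where "q \<in> polys_upto 2"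
    "p = (\<lambda>z. 1 * q z + 1 * (1 * (c30 * monom2 3 0 z + c21 * monom2 2 1 z)
        + 1 * (c12 * monom2 1 2 z + c03 * monom2 0 3 z)))"
proof -
  from assms obtain q c30 c21 c12 c03 where "q \<in> polys_upto 2" and "\<forall>x y.
     p (x, y) = q (x, y) + c30 * x ^ 3 + c21 * x\<^sup>2 * y + c12 * x * y\<^sup>2 + c03 * y ^ 3"
    unfolding polys_upto_3_iff by blast
  then show ?thesis
    by (intro that[of q c30 c21 c12 c03]) (auto simp: fun_eq_iff monom2_def)
qed

lemma polys_upto_2_monom:
  assumes "p \<in> polys_upto 2"
  obtains c00 c10 c01 c20 c11 c02 where
    "p = (\<lambda>z. 1 * (1 * (c00 * monom2 0 0 z + c10 * monom2 1 0 z) +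
        1 * (c01 * monom2 0 1 z + c20 * monom2 2 0 z)) + 1 * (c11 * monom2 1 1 z + c02 * monom2 0 2 z))"
proof -
  from assms obtain c00 c10 c01 c20 c11 c02 where
    "\<forall>x y. p (x, y) = c00 + c10 * x + c01 * y + c20 * x\<^sup>2 + c11 * x * y + c02 * y\<^sup>2"
    unfolding polys_upto_2_iff by blast
  then show ?thesis
    by (intro that[of c00 c10 c01 c20 c11 c02]) (auto simp: fun_eq_iff monom2_def)
qed

lemma monom2_in_polys:
  assumes "a + b \<le> n" shows "monom2 a b \<in> polys_upto n"
  unfolding polys_upto_def monom2_def
proof (intro CollectI exI allI)
  fix x y :: real
  have "(\<Sum>a'\<le>n. \<Sum>b'\<le>n - a'. of_bool (a' = a) * of_bool (b' = b) * x ^ a' * y ^ b')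
    = (\<Sum>a'\<le>n. if a' = a then \<Sum>b'\<le>n - a. (if b' = b then x ^ a * y ^ b else 0) else 0)"
    by (intro sum.cong refl) (auto intro!: sum.cong simp del: sum.delta sum.delta')
  also have "\<dots> = x ^ a * y ^ b" using assms by simp
  finally show "(case (x, y) of (x, y) \<Rightarrow> x ^ a * y ^ b) =
    (\<Sum>a'\<le>n. \<Sum>b'\<le>n - a'. of_bool (a' = a) * of_bool (b' = b) * x ^ a' * y ^ b')"
    by simp
qed

lemma Ck_polys_2: "p \<in> polys_upto 2 \<Longrightarrow> Ck k p"
  by (erule polys_upto_2_monom) (simp only: Ck_lincomb Ck_monom2)

lemma Ck_polys_3: "p \<in> polys_upto 3 \<Longrightarrow> Ck k p"
  by (erule polys_upto_3_monom) (simp only: Ck_lincomb Ck_monom2 Ck_polys_2)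

lemma partially_differentiable_polys: "p \<in> polys_upto 3 \<Longrightarrow> partially_differentiable p"
  using Ck_1_partially_differentiable Ck_polys_3 by blast

lemma polys_upto_2_affine:
  assumes "p \<in> polys_upto 2" shows "(\<lambda>z. p (v + h *\<^sub>R z)) \<in> polys_upto 2"
proof -
  from assms obtain c00 c10 c01 c20 c11 c02 where c:
    "\<forall>x y. p (x, y) = c00 + c10 * x + c01 * y + c20 * x\<^sup>2 + c11 * x * y + c02 * y\<^sup>2"
    unfolding polys_upto_2_iff by blast
  obtain u w where v: "v = (u, w)" by fastforce
  show ?thesis unfolding polys_upto_2_iff
    by (rule exI[of _ "p v"], rule exI[of _ "h * (c10 + 2 * c20 * u + c11 * w)"],
      rule exI[of _ "h * (c01 + 2 * c02 * w + c11 * u)"], rule exI[of _ "h\<^sup>2 * c20"],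
      rule exI[of _ "h\<^sup>2 * c11"], rule exI[of _ "h\<^sup>2 * c02"])
      (simp add: c v power2_eq_square algebra_simps)
qed

text \<open>
  A difference lowers the degree. This transports exactness on quadratics to statements about cubics: a
  functional that is exact on quadratics has the same error on a cubic at every vertex.
\<close>
lemma polys_upto_3_shift_diff:
  assumes "p \<in> polys_upto 3" shows "(\<lambda>z. 1 * p (z + v) + (-1) * p z) \<in> polys_upto 2"
proof -
  from assms obtain q c30 c21 c12 c03 where q: "q \<in> polys_upto 2" and p: "\<forall>x y.
     p (x, y) = q (x, y) + c30 * x ^ 3 + c21 * x\<^sup>2 * y + c12 * x * y\<^sup>2 + c03 * y ^ 3"
    unfolding polys_upto_3_iff by blast
  from q obtain c00 c10 c01 c20 c11 c02 where
    "\<forall>x y. q (x, y) = c00 + c10 * x + c01 * y + c20 * x\<^sup>2 + c11 * x * y + c02 * y\<^sup>2"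
    unfolding polys_upto_2_iff by blast
  with p have c: "p (x, y) = c00 + c10 * x + c01 * y + c20 * x\<^sup>2 + c11 * x * y + c02 * y\<^sup>2
      + c30 * x ^ 3 + c21 * x\<^sup>2 * y + c12 * x * y\<^sup>2 + c03 * y ^ 3" for x y by simp
  obtain u w where v: "v = (u, w)" by fastforce
  show ?thesis unfolding polys_upto_2_iff
    by (rule exI[of _ "p v - c00"],
      rule exI[of _ "2 * c20 * u + c11 * w + 3 * c30 * u\<^sup>2 + 2 * c21 * u * w + c12 * w\<^sup>2"],
      rule exI[of _ "2 * c02 * w + c11 * u + 3 * c03 * w\<^sup>2 + 2 * c12 * u * w + c21 * u\<^sup>2"],
      rule exI[of _ "3 * c30 * u + c21 * w"], rule exI[of _ "2 * c21 * u + 2 * c12 * w"],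
      rule exI[of _ "3 * c03 * w + c12 * u"]) (simp add: c v power2_eq_square power3_eq_cube algebra_simps)
qed

lemma polys_upto_2_add:
  assumes "p \<in> polys_upto 2" "q \<in> polys_upto 2" shows "(\<lambda>z. p z + q z) \<in> polys_upto 2"
proof -
  from assms obtain c00 c10 c01 c20 c11 c02 d00 d10 d01 d20 d11 d02 where
    "\<forall>x y. p (x, y) = c00 + c10 * x + c01 * y + c20 * x\<^sup>2 + c11 * x * y + c02 * y\<^sup>2"
    "\<forall>x y. q (x, y) = d00 + d10 * x + d01 * y + d20 * x\<^sup>2 + d11 * x * y + d02 * y\<^sup>2"
    unfolding polys_upto_2_iff by blast
  then show ?thesis unfolding polys_upto_2_iff
    by (intro exI[of _ "c00 + d00"] exI[of _ "c10 + d10"] exI[of _ "c01 + d01"]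
      exI[of _ "c20 + d20"] exI[of _ "c11 + d11"] exI[of _ "c02 + d02"])
      (simp add: algebra_simps)
qed

lemma polys_upto_3_affine:
  assumes "p \<in> polys_upto 3" shows "(\<lambda>z. p (v + h *\<^sub>R z)) \<in> polys_upto 3"
proof -
  from assms obtain q c30 c21 c12 c03 where q: "q \<in> polys_upto 2" and c:
    "\<forall>x y. p (x, y) = q (x, y) + c30 * x ^ 3 + c21 * x\<^sup>2 * y + c12 * x * y\<^sup>2 + c03 * y ^ 3"
    unfolding polys_upto_3_iff by blast
  define r where "r = (\<lambda>z. 1 * p (z + v) + (-1) * p z)"
  have r: "r \<in> polys_upto 2" unfolding r_def by (rule polys_upto_3_shift_diff[OF assms])
  let ?q = "\<lambda>z. q (0 + h *\<^sub>R z) + r (0 + h *\<^sub>R z)"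
  have "?q \<in> polys_upto 2" by (intro polys_upto_2_add polys_upto_2_affine q r)
  moreover have "p (v + h *\<^sub>R (x, y)) = ?q (x, y) + (h ^ 3 * c30) * x ^ 3
    + (h ^ 3 * c21) * x\<^sup>2 * y + (h ^ 3 * c12) * x * y\<^sup>2 + (h ^ 3 * c03) * y ^ 3" for x y
  proof -
    have "p (v + h *\<^sub>R (x, y)) = r (h *\<^sub>R (x, y)) + p (h * x, h * y)"
      by (simp add: r_def add.commute)
    then show ?thesis by (simp add: c power2_eq_square power3_eq_cube algebra_simps)
  qed
  ultimately show ?thesis unfolding polys_upto_3_iff
    by (intro bexI[of _ ?q] exI[of _ "h ^ 3 * c30"] exI[of _ "h ^ 3 * c21"]
      exI[of _ "h ^ 3 * c12"] exI[of _ "h ^ 3 * c03"]) auto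
qed

section \<open>Smoothness across sides\<close>

text \<open>
  A spline that is smooth along a line crossing a side has equal slopes on both sides of it, although it is
  given by different polynomials there.
\<close>
lemma one_sided_derivatives_agree:
  fixes g p n :: "real \<Rightarrow> real"
  assumes g: "g differentiable at 0" and d: "d > 0"
    and gp: "\<And>u. 0 \<le> u \<Longrightarrow> u < d \<Longrightarrow> g u = p u"
    and gn: "\<And>u. - d < u \<Longrightarrow> u \<le> 0 \<Longrightarrow> g u = n u"
    and p: "(p has_real_derivative p') (at 0)" and n: "(n has_real_derivative n') (at 0)"
  shows "p' = n'"
proof -
  obtain D where D: "(g has_real_derivative D) (at 0)"
    using g real_differentiable_def by blast
  have "(g has_real_derivative p') (at 0 within {0..})"
    by (rule has_field_derivative_transform_within[OF has_field_derivative_at_within[OF p] d])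
      (use gp d in \<open>auto simp: dist_real_def\<close>)
  then have "((\<lambda>u. (g u - g 0) / (u - 0)) \<longlongrightarrow> p') (at 0 within {0..})"
    by (simp add: has_field_derivative_iff)
  then have 1: "((\<lambda>u. (g u - g 0) / (u - 0)) \<longlongrightarrow> p') (at_right 0)"
    by (rule tendsto_within_subset) auto
  have "(g has_real_derivative n') (at 0 within {..0})"
    by (rule has_field_derivative_transform_within[OF has_field_derivative_at_within[OF n] d])
      (use gn d in \<open>auto simp: dist_real_def\<close>)
  then have "((\<lambda>u. (g u - g 0) / (u - 0)) \<longlongrightarrow> n') (at 0 within {..0})"
    by (simp add: has_field_derivative_iff)
  then have 2: "((\<lambda>u. (g u - g 0) / (u - 0)) \<longlongrightarrow> n') (at_left 0)"
    by (rule tendsto_within_subset) auto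
  have "((\<lambda>u. (g u - g 0) / (u - 0)) \<longlongrightarrow> D) (at 0)"
    using D by (simp add: has_field_derivative_iff)
  then have 3: "((\<lambda>u. (g u - g 0) / (u - 0)) \<longlongrightarrow> D) (at_left 0)"
    "((\<lambda>u. (g u - g 0) / (u - 0)) \<longlongrightarrow> D) (at_right 0)"
    by (simp_all add: filterlim_at_split)
  show ?thesis
    using tendsto_unique[OF _ 1 3(2)] tendsto_unique[OF _ 2 3(1)] by simp
qed

definition bernstein_form :: "real \<Rightarrow> real \<Rightarrow> real \<Rightarrow> real \<Rightarrow> real \<Rightarrow> real \<Rightarrow> real \<Rightarrow> real \<Rightarrow> real \<Rightarrow> real
    \<Rightarrow> real \<Rightarrow> real \<Rightarrow> real \<Rightarrow> real" where
  "bernstein_form c300 c210 c201 c120 c111 c102 c030 c021 c012 c003 a b c =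
     c300 * a ^ 3 + 3 * c210 * a\<^sup>2 * b + 3 * c201 * a\<^sup>2 * c + 3 * c120 * a * b\<^sup>2
   + 6 * c111 * a * b * c + 3 * c102 * a * c\<^sup>2 + c030 * b ^ 3 + 3 * c021 * b\<^sup>2 * c
   + 3 * c012 * b * c\<^sup>2 + c003 * c ^ 3"

lemma bernstein_form_deriv:
  "((\<lambda>u. bernstein_form c300 c210 c201 c120 c111 c102 c030 c021 c012 c003
        (a + a' * u) (b + b' * u) (c + c' * u)) has_real_derivative
    3 * (a' * (c300 * a\<^sup>2 + 2 * c210 * a * b + 2 * c201 * a * c + c120 * b\<^sup>2 + 2 * c111 * b * c + c102 * c\<^sup>2)
       + b' * (c210 * a\<^sup>2 + 2 * c120 * a * b + 2 * c111 * a * c + c030 * b\<^sup>2 + 2 * c021 * b * c + c012 * c\<^sup>2)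
       + c' * (c201 * a\<^sup>2 + 2 * c111 * a * b + 2 * c102 * a * c + c021 * b\<^sup>2 + 2 * c012 * b * c + c003 * c\<^sup>2)))
    (at 0)"
  unfolding bernstein_form_def
  by (rule derivative_eq_intros refl)+ (simp add: algebra_simps power2_eq_square)

text \<open>
  The derivative across a side, restricted to the side, is a quadratic in Bernstein form; comparing the
  coefficients of the two sides gives three relations for each side.
\<close>
lemma bernstein_quadratic_coeffs:
  fixes a0 a1 a2 b0 b1 b2 :: real
  assumes "\<And>r. 0 < r \<Longrightarrow> r < 1 \<Longrightarrow>
    a0 * (1 - r)\<^sup>2 + 2 * a1 * (1 - r) * r + a2 * r\<^sup>2 = b0 * (1 - r)\<^sup>2 + 2 * b1 * (1 - r) * r + b2 * r\<^sup>2"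
  shows "a0 = b0" "a1 = b1" "a2 = b2"
  using assms[of "1 / 4"] assms[of "1 / 2"] assms[of "3 / 4"]
  by (simp_all add: power2_eq_square field_simps)

text \<open>
  In lattice coordinates $(s, t)$ the point is $(h(s+t), h(s-t))$. The diagonal sides are parallel to the
  $x$-axis and are crossed in the direction of $y$, the other sides are crossed in the direction of $x$.
\<close>
lemma section_y_differentiable:
  assumes "partially_differentiable q"
  shows "(\<lambda>u. q (h * ((s + u) + (t - u)), h * ((s + u) - (t - u)))) differentiable at 0"
proof -
  have "((\<lambda>u. q (h * (s + t), h * (s - t) + 2 * h * u)) has_real_derivative
      partial_y q (h * (s + t), h * (s - t)) * (2 * h)) (at 0)"
    by (rule DERIV_chain'[of "\<lambda>u. h * (s - t) + 2 * h * u"])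
      (use has_partial_y[OF assms] in \<open>auto intro!: derivative_eq_intros\<close>)
  then show ?thesis
    unfolding real_differentiable_def by (auto simp: algebra_simps)
qed

lemma section_x_differentiable:
  assumes "partially_differentiable q"
  shows "(\<lambda>u. q (h * ((s + u) + (t + u)), h * ((s + u) - (t + u)))) differentiable at 0"
proof -
  have "((\<lambda>u. q (h * (s + t) + 2 * h * u, h * (s - t))) has_real_derivative
      partial_x q (h * (s + t), h * (s - t)) * (2 * h)) (at 0)"
    by (rule DERIV_chain'[of "\<lambda>u. h * (s + t) + 2 * h * u"])
      (use has_partial_x[OF assms] in \<open>auto intro!: derivative_eq_intros\<close>)
  then show ?thesis
    unfolding real_differentiable_def by (auto simp: algebra_simps)
qed

definition side_dirs :: "(int \<times> int) set" where
  "side_dirs = {(1, 0), (0, 1), (1, 1)}"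

context
  fixes M :: masks and h :: real and f :: "plane \<Rightarrow> real"
  assumes h: "h > 0"
begin

\<comment> \<open>The coefficients $V$, $U^{k,m}$, $C$, $\widetilde{C}$ and the quasi-interpolant of one fixed function.\<close>
abbreviation "VV \<equiv> mask_apply h (\<alpha> M) f"
abbreviation "UU k m \<equiv> mask_apply h (\<beta> M k m) f"
abbreviation "CC \<equiv> mask_apply h (\<gamma> M) f"
abbreviation "CC' \<equiv> mask_apply h (\<gamma>' M) f"
abbreviation "QQ \<equiv> quasi_interp M h f"

lemma quasi_interp_T_lattice:
  assumes "j \<le> t" "t - j \<le> s - i" "s \<le> i + 1"
  shows "QQ (h * (s + t), h * (s - t)) =
    bernstein_form (VV i j) (UU 1 1 i j) (UU 1 0 i j) (UU (-1) (-1) (i + 1) (j + 1)) (CC i j)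
      (UU (-1) 0 (i + 1) j) (VV (i + 1) (j + 1)) (UU 0 (-1) (i + 1) (j + 1)) (UU 0 1 (i + 1) j)
      (VV (i + 1) j) (1 - (s - i)) (t - j) ((s - i) - (t - j))"
proof -
  have "(h * (s + t), h * (s - t)) \<in> tri_T h i j"
    using assms by (simp add: mem_tri_T[OF h])
  from quasi_interp_on_T[OF h this] show ?thesis
    unfolding piece_T_def bernstein3_def Let_def bary_T[OF h] prod.case
    by (simp add: bernstein_form_def fact_numeral power2_eq_square power3_eq_cube algebra_simps)
qed

lemma quasi_interp_T'_lattice:
  assumes "i \<le> s" "s - i \<le> t - j" "t \<le> j + 1"
  shows "QQ (h * (s + t), h * (s - t)) =
    bernstein_form (VV i (j + 1)) (UU 1 0 i (j + 1)) (UU 0 (-1) i (j + 1)) (UU (-1) 0 (i + 1) (j + 1)) (CC' i j)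
      (UU 0 1 i j) (VV (i + 1) (j + 1)) (UU (-1) (-1) (i + 1) (j + 1)) (UU 1 1 i j)
      (VV i j) ((t - j) - (s - i)) (s - i) (1 - (t - j))"
proof -
  have "(h * (s + t), h * (s - t)) \<in> tri_T' h i j"
    using assms by (simp add: mem_tri_T'[OF h])
  from quasi_interp_on_T'[OF h this] show ?thesis
    unfolding piece_T'_def bernstein3_def Let_def bary_T'[OF h] prod.case
    by (simp add: bernstein_form_def fact_numeral power2_eq_square power3_eq_cube algebra_simps)
qed

context
  assumes smooth: "partially_differentiable QQ"
begin

text \<open>
  Two triangles that share a side form a parallelogram with the side as its diagonal. Hence smoothness
  requires, for each pair of neighbouring Bernstein coefficients on the side, that the two coefficients
  adjacent to the pair, one in each triangle, have the same sum as the pair. The next three lemmas say this for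
  the three families of sides.
\<close>
lemma join_diagonal:
  "UU 1 0 i j + UU 0 1 i j = VV i j + UU 1 1 i j"
  "CC i j + CC' i j = UU 1 1 i j + UU (-1) (-1) (i + 1) (j + 1)"
  "UU 0 (-1) (i + 1) (j + 1) + UU (-1) 0 (i + 1) (j + 1) = UU (-1) (-1) (i + 1) (j + 1) + VV (i + 1) (j + 1)"
proof -
  have "(UU 1 0 i j + UU 0 1 i j) * (1 - r)\<^sup>2 + 2 * (CC i j + CC' i j) * (1 - r) * r + (UU 0 (-1) (i + 1) (j + 1) + UU (-1) 0 (i + 1) (j + 1)) * r\<^sup>2
    = (VV i j + UU 1 1 i j) * (1 - r)\<^sup>2 + 2 * (UU 1 1 i j + UU (-1) (-1) (i + 1) (j + 1)) * (1 - r) * r + (UU (-1) (-1) (i + 1) (j + 1) + VV (i + 1) (j + 1)) * r\<^sup>2"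
    if r: "0 < r" "r < 1" for r :: real
  proof -
    define g where "g = (\<lambda>u :: real. QQ (h * ((i + r + u) + (j + r - u)), h * ((i + r + u) - (j + r - u))))"
    have g: "g differentiable at 0"
      unfolding g_def by (rule section_y_differentiable[OF smooth])
    have d: "min r (1 - r) > 0" using r by auto
    have gp: "g u = bernstein_form (VV i j) (UU 1 1 i j) (UU 1 0 i j) (UU (-1) (-1) (i + 1) (j + 1)) (CC i j)
        (UU (-1) 0 (i + 1) j) (VV (i + 1) (j + 1)) (UU 0 (-1) (i + 1) (j + 1)) (UU 0 1 (i + 1) j) (VV (i + 1) j) (1 - r + - 1 * u) (r + - 1 * u) (0 + 2 * u)"
      if "0 \<le> u" "u < min r (1 - r)" for u :: real
      unfolding g_def by (subst quasi_interp_T_lattice[where i = i and j = j]) (use that in \<open>auto simp: algebra_simps\<close>)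
    have gn: "g u = bernstein_form (VV i (j + 1)) (UU 1 0 i (j + 1)) (UU 0 (-1) i (j + 1)) (UU (-1) 0 (i + 1) (j + 1)) (CC' i j)
        (UU 0 1 i j) (VV (i + 1) (j + 1)) (UU (-1) (-1) (i + 1) (j + 1)) (UU 1 1 i j) (VV i j) (0 + - 2 * u) (r + 1 * u) (1 - r + 1 * u)"
      if "- min r (1 - r) < u" "u \<le> 0" for u :: real
      unfolding g_def by (subst quasi_interp_T'_lattice[where i = i and j = j]) (use that in \<open>auto simp: algebra_simps\<close>)
    from one_sided_derivatives_agree[OF g d gp gn bernstein_form_deriv bernstein_form_deriv]
    show ?thesis by (simp add: algebra_simps power2_eq_square)
  qed
  from bernstein_quadratic_coeffs[OF this] show
    "UU 1 0 i j + UU 0 1 i j = VV i j + UU 1 1 i j"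
    "CC i j + CC' i j = UU 1 1 i j + UU (-1) (-1) (i + 1) (j + 1)"
    "UU 0 (-1) (i + 1) (j + 1) + UU (-1) 0 (i + 1) (j + 1) = UU (-1) (-1) (i + 1) (j + 1) + VV (i + 1) (j + 1)" by blast+
qed

lemma join_first:
  "UU 1 1 i j + UU 0 (-1) i j = VV i j + UU 1 0 i j"
  "CC i j + CC' i (j - 1) = UU 1 0 i j + UU (-1) 0 (i + 1) j"
  "UU 0 1 (i + 1) j + UU (-1) (-1) (i + 1) j = UU (-1) 0 (i + 1) j + VV (i + 1) j"
proof -
  have "(UU 1 1 i j + UU 0 (-1) i j) * (1 - r)\<^sup>2 + 2 * (CC i j + CC' i (j - 1)) * (1 - r) * r + (UU 0 1 (i + 1) j + UU (-1) (-1) (i + 1) j) * r\<^sup>2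
    = (VV i j + UU 1 0 i j) * (1 - r)\<^sup>2 + 2 * (UU 1 0 i j + UU (-1) 0 (i + 1) j) * (1 - r) * r + (UU (-1) 0 (i + 1) j + VV (i + 1) j) * r\<^sup>2"
    if r: "0 < r" "r < 1" for r :: real
  proof -
    define g where "g = (\<lambda>u :: real. QQ (h * ((i + r + u) + (j + u)), h * ((i + r + u) - (j + u))))"
    have g: "g differentiable at 0"
      unfolding g_def by (rule section_x_differentiable[OF smooth])
    have d: "min r (1 - r) > 0" using r by auto
    have gp: "g u = bernstein_form (VV i j) (UU 1 1 i j) (UU 1 0 i j) (UU (-1) (-1) (i + 1) (j + 1)) (CC i j)
        (UU (-1) 0 (i + 1) j) (VV (i + 1) (j + 1)) (UU 0 (-1) (i + 1) (j + 1)) (UU 0 1 (i + 1) j) (VV (i + 1) j) (1 - r + - 1 * u) (0 + 1 * u) (r + 0 * u)"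
      if "0 \<le> u" "u < min r (1 - r)" for u :: real
      unfolding g_def by (subst quasi_interp_T_lattice[where i = i and j = j]) (use that in \<open>auto simp: algebra_simps\<close>)
    have gn: "g u = bernstein_form (VV i j) (UU 1 0 i j) (UU 0 (-1) i j) (UU (-1) 0 (i + 1) j) (CC' i (j - 1))
        (UU 0 1 i (j - 1)) (VV (i + 1) j) (UU (-1) (-1) (i + 1) j) (UU 1 1 i (j - 1)) (VV i (j - 1)) (1 - r + 0 * u) (r + 1 * u) (0 + - 1 * u)"
      if "- min r (1 - r) < u" "u \<le> 0" for u :: real
      unfolding g_def by (subst quasi_interp_T'_lattice[where i = i and j = "j - 1"]) (use that in \<open>auto simp: algebra_simps\<close>)
    from one_sided_derivatives_agree[OF g d gp gn bernstein_form_deriv bernstein_form_deriv]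
    show ?thesis by (simp add: algebra_simps power2_eq_square)
  qed
  from bernstein_quadratic_coeffs[OF this] show
    "UU 1 1 i j + UU 0 (-1) i j = VV i j + UU 1 0 i j"
    "CC i j + CC' i (j - 1) = UU 1 0 i j + UU (-1) 0 (i + 1) j"
    "UU 0 1 (i + 1) j + UU (-1) (-1) (i + 1) j = UU (-1) 0 (i + 1) j + VV (i + 1) j" by blast+
qed

lemma join_second:
  "UU 1 1 i j + UU (-1) 0 i j = VV i j + UU 0 1 i j"
  "CC' i j + CC (i - 1) j = UU 0 1 i j + UU 0 (-1) i (j + 1)"
  "UU 1 0 i (j + 1) + UU (-1) (-1) i (j + 1) = UU 0 (-1) i (j + 1) + VV i (j + 1)"
proof -
  have "(UU 1 1 i j + UU (-1) 0 i j) * (1 - r)\<^sup>2 + 2 * (CC' i j + CC (i - 1) j) * (1 - r) * r + (UU 1 0 i (j + 1) + UU (-1) (-1) i (j + 1)) * r\<^sup>2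
    = (VV i j + UU 0 1 i j) * (1 - r)\<^sup>2 + 2 * (UU 0 1 i j + UU 0 (-1) i (j + 1)) * (1 - r) * r + (UU 0 (-1) i (j + 1) + VV i (j + 1)) * r\<^sup>2"
    if r: "0 < r" "r < 1" for r :: real
  proof -
    define g where "g = (\<lambda>u :: real. QQ (h * ((i + u) + (j + r + u)), h * ((i + u) - (j + r + u))))"
    have g: "g differentiable at 0"
      unfolding g_def by (rule section_x_differentiable[OF smooth])
    have d: "min r (1 - r) > 0" using r by auto
    have gp: "g u = bernstein_form (VV i (j + 1)) (UU 1 0 i (j + 1)) (UU 0 (-1) i (j + 1)) (UU (-1) 0 (i + 1) (j + 1)) (CC' i j)
        (UU 0 1 i j) (VV (i + 1) (j + 1)) (UU (-1) (-1) (i + 1) (j + 1)) (UU 1 1 i j) (VV i j) (r + 0 * u) (0 + 1 * u) (1 - r + - 1 * u)"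
      if "0 \<le> u" "u < min r (1 - r)" for u :: real
      unfolding g_def by (subst quasi_interp_T'_lattice[where i = i and j = j]) (use that in \<open>auto simp: algebra_simps\<close>)
    have gn: "g u = bernstein_form (VV (i - 1) j) (UU 1 1 (i - 1) j) (UU 1 0 (i - 1) j) (UU (-1) (-1) i (j + 1)) (CC (i - 1) j)
        (UU (-1) 0 i j) (VV i (j + 1)) (UU 0 (-1) i (j + 1)) (UU 0 1 i j) (VV i j) (0 + - 1 * u) (r + 1 * u) (1 - r + 0 * u)"
      if "- min r (1 - r) < u" "u \<le> 0" for u :: real
      unfolding g_def by (subst quasi_interp_T_lattice[where i = "i - 1" and j = j]) (use that in \<open>auto simp: algebra_simps\<close>)
    from one_sided_derivatives_agree[OF g d gp gn bernstein_form_deriv bernstein_form_deriv]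
    show ?thesis by (simp add: algebra_simps power2_eq_square)
  qed
  from bernstein_quadratic_coeffs[OF this] show
    "UU 1 1 i j + UU (-1) 0 i j = VV i j + UU 0 1 i j"
    "CC' i j + CC (i - 1) j = UU 0 1 i j + UU 0 (-1) i (j + 1)"
    "UU 1 0 i (j + 1) + UU (-1) (-1) i (j + 1) = UU 0 (-1) i (j + 1) + VV i (j + 1)" by blast+
qed

text \<open>
  The coefficients next to a vertex lie in the tangent plane there. The identities follow by adding the
  relations of two consecutive sides at the vertex.
\<close>
lemma opposite_sum:
  "UU 1 0 i j + UU (-1) 0 i j = 2 * VV i j"
  "UU 0 1 i j + UU 0 (-1) i j = 2 * VV i j"
  "UU 1 1 i j + UU (-1) (-1) i j = 2 * VV i j"
  using join_diagonal(1)[of i j] join_diagonal(3)[of "i - 1" "j - 1"] join_first(1)[of i j]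
    join_first(3)[of "i - 1" j] join_second(1)[of i j] join_second(3)[of i "j - 1"]
  by simp_all

end

lemma quasi_interp_on_side:
  assumes kl: "(k, l) \<in> side_dirs" and u: "0 \<le> u" "u \<le> 1"
  shows "QQ (vtx h i j + u *\<^sub>R vtx h k l) =
    VV i j * (1 - u) ^ 3 + 3 * UU k l i j * (1 - u)\<^sup>2 * u
    + 3 * UU (- k) (- l) (i + k) (j + l) * (1 - u) * u\<^sup>2 + VV (i + k) (j + l) * u ^ 3"
proof -
  have v: "vtx h i j + u *\<^sub>R vtx h k l
    = (h * ((i + u * k) + (j + u * l)), h * ((i + u * k) - (j + u * l)))"
    by (simp add: vtx_def algebra_simps)
  consider "k = 1" "l = 0" | "k = 0" "l = 1" | "k = 1" "l = 1"
    using kl by (auto simp: side_dirs_def)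
  then show ?thesis
  proof cases
    case 1
    then show ?thesis unfolding v
      by (subst quasi_interp_T_lattice[where i = i and j = j])
        (use u in \<open>auto simp: bernstein_form_def algebra_simps\<close>)
  next
    case 2
    then show ?thesis unfolding v
      by (subst quasi_interp_T'_lattice[where i = i and j = j])
        (use u in \<open>auto simp: bernstein_form_def algebra_simps\<close>)
  next
    case 3
    then show ?thesis unfolding v
      by (subst quasi_interp_T_lattice[where i = i and j = j])
        (use u in \<open>auto simp: bernstein_form_def algebra_simps\<close>)
  qed
qed

end

section \<open>Exactness on quadratics and the error at midpoints\<close>

lemma polys_upto_2_on_line:
  assumes "p \<in> polys_upto 2"
  obtains c0 c1 c2 where "\<And>u. p (v + u *\<^sub>R w) = c0 + c1 * u + c2 * u\<^sup>2"
proof -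
  from assms obtain c00 c10 c01 c20 c11 c02 where c:
    "\<forall>x y. p (x, y) = c00 + c10 * x + c01 * y + c20 * x\<^sup>2 + c11 * x * y + c02 * y\<^sup>2"
    unfolding polys_upto_2_iff by blast
  obtain a b d e where v: "v = (a, b)" "w = (d, e)" by fastforce
  show ?thesis
    by (rule that[of "p v" "c10 * d + c01 * e + 2 * c20 * a * d + c11 * (a * e + b * d) + 2 * c02 * b * e"
          "c20 * d\<^sup>2 + c11 * d * e + c02 * e\<^sup>2"])
      (simp add: c v power2_eq_square algebra_simps)
qed

lemma polys_upto_3_on_line:
  assumes "p \<in> polys_upto 3"
  obtains c0 c1 c2 c3 where "\<And>u. p (v + u *\<^sub>R w) = c0 + c1 * u + c2 * u\<^sup>2 + c3 * u ^ 3"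
proof -
  from assms obtain q c30 c21 c12 c03 where q: "q \<in> polys_upto 2" and c: "\<forall>x y.
     p (x, y) = q (x, y) + c30 * x ^ 3 + c21 * x\<^sup>2 * y + c12 * x * y\<^sup>2 + c03 * y ^ 3"
    unfolding polys_upto_3_iff by blast
  from polys_upto_2_on_line[OF q, of v w] obtain c0 c1 c2 where
    c2: "q (v + u *\<^sub>R w) = c0 + c1 * u + c2 * u\<^sup>2" for u by blast
  obtain a b d e where v: "v = (a, b)" "w = (d, e)" by fastforce
  have q': "q (a + u * d, b + u * e) = c0 + c1 * u + c2 * u\<^sup>2" for u
    using c2[of u] by (simp add: v)
  show ?thesis
    by (rule that[of "c0 + c30 * a ^ 3 + c21 * a\<^sup>2 * b + c12 * a * b\<^sup>2 + c03 * b ^ 3"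
      "c1 + 3 * c30 * a\<^sup>2 * d + c21 * (2 * a * b * d + a\<^sup>2 * e) + c12 * (2 * a * b * e + b\<^sup>2 * d) + 3 * c03 * b\<^sup>2 * e"
      "c2 + 3 * c30 * a * d\<^sup>2 + c21 * (2 * a * d * e + b * d\<^sup>2) + c12 * (2 * b * d * e + a * e\<^sup>2) + 3 * c03 * b * e\<^sup>2"
      "c30 * d ^ 3 + c21 * d\<^sup>2 * e + c12 * d * e\<^sup>2 + c03 * e ^ 3"])
      (simp add: c v q' power2_eq_square power3_eq_cube algebra_simps)
qed

locale exact_C1_masks =
  fixes M :: masks
  assumes exact: "\<And>h p. h > 0 \<Longrightarrow> p \<in> polys_upto 2 \<Longrightarrow> quasi_interp M h p = p"
    and smooth: "\<And>h f. h > 0 \<Longrightarrow> Ck 1 f \<Longrightarrow> quasi_interp M h f \<in> S31 h"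
begin

lemma smooth_partially_differentiable:
  "h > 0 \<Longrightarrow> Ck 1 f \<Longrightarrow> partially_differentiable (quasi_interp M h f)"
  using smooth Ck_1_partially_differentiable unfolding S31_def by blast

lemma backward_edge_value:
  assumes "h > 0" "Ck 1 f" "(k, l) \<in> side_dirs"
  shows "mask_apply h (\<beta> M (- k) (- l)) f i j =
    2 * mask_apply h (\<alpha> M) f i j - mask_apply h (\<beta> M k l) f i j"
  using assms(3) opposite_sum[OF assms(1) smooth_partially_differentiable[OF assms(1,2)], of i j]
  by (auto simp: side_dirs_def)

lemma vertex_exact:
  assumes "h > 0" "p \<in> polys_upto 2"
  shows "mask_apply h (\<alpha> M) p i j = p (vtx h i j)"
  using quasi_interp_on_side[OF assms(1), of 1 0 0 M p i j] exact[OF assms]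
  by (simp add: side_dirs_def)

text \<open>
  The spline restricted to a side is a univariate cubic and its four coefficients are determined by its values. Where
  it reproduces a quadratic, the coefficient next to the vertex is therefore that of the quadratic, written here
  through the values at the midpoint and at the far end.
\<close>
lemma edge_exact:
  assumes h: "h > 0" and p: "p \<in> polys_upto 2" and kl: "(k, l) \<in> side_dirs"
  shows "mask_apply h (\<beta> M k l) p i j =
    (4 * p (vtx h i j + (1 / 2) *\<^sub>R vtx h k l) - p (vtx h (i + k) (j + l))) / 3"
proof -
  from polys_upto_2_on_line[OF p, of "vtx h i j" "vtx h k l"] obtain c0 c1 c2 where
    c: "p (vtx h i j + u *\<^sub>R vtx h k l) = c0 + c1 * u + c2 * u\<^sup>2" for u by blast
  have v1: "vtx h (i + k) (j + l) = vtx h i j + 1 *\<^sub>R vtx h k l"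
    by (simp add: vtx_def algebra_simps)
  have v0: "mask_apply h (\<alpha> M) p i j = c0"
    using c[of 0] by (simp add: vertex_exact[OF h p])
  have v1': "mask_apply h (\<alpha> M) p (i + k) (j + l) = c0 + c1 + c2"
    unfolding vertex_exact[OF h p] v1 c by simp
  have "c0 + c1 * u + c2 * u\<^sup>2 = c0 * (1 - u) ^ 3 + 3 * mask_apply h (\<beta> M k l) p i j * (1 - u)\<^sup>2 * u
    + 3 * mask_apply h (\<beta> M (- k) (- l)) p (i + k) (j + l) * (1 - u) * u\<^sup>2 + (c0 + c1 + c2) * u ^ 3"
    if "0 \<le> u" "u \<le> 1" for u
    using quasi_interp_on_side[OF h kl that, of M p i j] unfolding exact[OF h p] c v0 v1' .
  from this[of "1 / 3"] this[of "2 / 3"]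
  show ?thesis unfolding v1 c by (simp add: power2_eq_square power3_eq_cube field_simps)
qed

text \<open>
  Replacing the coefficient next to the far end by its opposite leaves only functionals that point in the same
  direction, so that translation relates the two ends.
\<close>
lemma quasi_interp_at_midpoint:
  assumes h: "h > 0" and f: "Ck 1 f" and kl: "(k, l) \<in> side_dirs"
  shows "quasi_interp M h f (vtx h i j + (1 / 2) *\<^sub>R vtx h k l) =
    (mask_apply h (\<alpha> M) f i j + 7 * mask_apply h (\<alpha> M) f (i + k) (j + l)
      + 3 * mask_apply h (\<beta> M k l) f i j - 3 * mask_apply h (\<beta> M k l) f (i + k) (j + l)) / 8"
  using quasi_interp_on_side[OF h kl, of "1 / 2" M f i j]
  by (simp add: backward_edge_value[OF h f kl] power2_eq_square power3_eq_cube field_simps)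

text \<open>
  For a cubic $p$ with difference $r = p(\cdot + e) - p$ the data at the far end exceed those at the near
  end by $V(r)$ and $U(r)$, which are known because $r$ is quadratic. What remains unknown is $V(p)$ at the
  near end alone: $U(p)$ cancels at the midpoint.
\<close>
lemma midpoint_error_cubic:
  assumes h: "h > 0" and p: "p \<in> polys_upto 3" and kl: "(k, l) \<in> side_dirs"
    and q_def: "q = vtx h i j + (1 / 2) *\<^sub>R vtx h k l"
  shows "quasi_interp M h p q - p q = mask_apply h (\<alpha> M) p i j - p (vtx h i j)"
proof -
  let ?e = "vtx h k l"
  define r where "r = (\<lambda>z. 1 * p (z + ?e) + (-1) * p z)"
  have r: "r \<in> polys_upto 2" unfolding r_def by (rule polys_upto_3_shift_diff[OF p])
  have pd: "partially_differentiable p" by (rule partially_differentiable_polys[OF p])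
  have pd': "partially_differentiable (\<lambda>z. p (z + ?e))"
    using partials_affine(1)[OF pd, of ?e 1] by (simp add: add.commute)
  have diff: "mask_apply h m p (i + k) (j + l) = mask_apply h m p i j + mask_apply h m r i j" for m
    unfolding mask_apply_shift[OF pd] r_def mask_apply_lincomb[OF pd' pd] by simp
  from polys_upto_3_on_line[OF p, of "vtx h i j" ?e] obtain c0 c1 c2 c3 where
    c: "p (vtx h i j + u *\<^sub>R ?e) = c0 + c1 * u + c2 * u\<^sup>2 + c3 * u ^ 3" for u by blast
  have rc: "r (vtx h i j + u *\<^sub>R ?e) = c1 + c2 * (2 * u + 1) + c3 * (3 * u\<^sup>2 + 3 * u + 1)" for u
  proof -
    have eq: "vtx h i j + u *\<^sub>R ?e + ?e = vtx h i j + (u + 1) *\<^sub>R ?e" by (simp add: algebra_simps)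
    show ?thesis unfolding r_def eq c by (simp add: power2_eq_square power3_eq_cube algebra_simps)
  qed
  have v1: "vtx h (i + k) (j + l) = vtx h i j + 1 *\<^sub>R ?e"
    by (simp add: vtx_def algebra_simps)
  have "mask_apply h (\<alpha> M) r i j = c1 + c2 + c3"
    using rc[of 0] by (simp add: vertex_exact[OF h r])
  moreover have "mask_apply h (\<beta> M k l) r i j
      = (4 * (c1 + 2 * c2 + c3 * (3 / 4 + 3 / 2 + 1)) - (c1 + 3 * c2 + 7 * c3)) / 3"
    unfolding edge_exact[OF h r kl] v1 rc by (simp add: power2_eq_square)
  moreover have "p q = c0 + c1 / 2 + c2 / 4 + c3 / 8" "p (vtx h i j) = c0"
    unfolding q_def using c[of "1 / 2"] c[of 0] by (simp_all add: power2_eq_square power3_eq_cube)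
  ultimately show ?thesis
    using quasi_interp_at_midpoint[OF h Ck_polys_3[OF p] kl, of i j]
    unfolding diff q_def by (simp add: field_simps)
qed

end

section \<open>The structure of the masks\<close>

text \<open>
  A continuously differentiable bump with value $1$ at $0$, value $0$ at all other integers, and slope $0$ at
  all integers. Products of \<open>bump x\<close> and \<open>x * bump x\<close> in the two variables carry a
  single unit datum at the origin of the lattice; \<open>bump'\<close> is the derivative.
\<close>
definition bump :: "real \<Rightarrow> real" where "bump x = (max 0 (1 - x\<^sup>2))\<^sup>2"
definition bump' :: "real \<Rightarrow> real" where "bump' x = - 4 * x * max 0 (1 - x\<^sup>2)"

lemma square_pos_part_deriv: "((\<lambda>w :: real. (max 0 w)\<^sup>2) has_real_derivative 2 * max 0 w) (at w)"
proof (cases w "0 :: real" rule: linorder_cases)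
  case less
  have "((\<lambda>w :: real. 0) has_real_derivative 2 * max 0 w) (at w)"
    using less by (auto intro!: derivative_eq_intros)
  then show ?thesis
    by (rule DERIV_cong_ev[THEN iffD1, rotated -1])
      (use less in \<open>auto intro!: eventually_mono[OF eventually_nhds_in_open[of "{..<0}"]]\<close>)
next
  case equal
  have "((\<lambda>u :: real. (max 0 u)\<^sup>2 / u) \<longlongrightarrow> 0) (at 0)"
  proof (rule Lim_null_comparison)
    show "\<forall>\<^sub>F u :: real in at 0. norm ((max 0 u)\<^sup>2 / u) \<le> \<bar>u\<bar>"
      by (intro always_eventually allI) (auto simp: max_def power2_eq_square)
    show "((\<lambda>u :: real. \<bar>u\<bar>) \<longlongrightarrow> 0) (at 0)"
      by (rule tendsto_rabs_zero) (rule tendsto_ident_at)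
  qed
  then show ?thesis unfolding equal has_field_derivative_iff by simp
next
  case greater
  have "((\<lambda>w :: real. w\<^sup>2) has_real_derivative 2 * max 0 w) (at w)"
    using greater by (auto intro!: derivative_eq_intros)
  then show ?thesis
    by (rule DERIV_cong_ev[THEN iffD1, rotated -1])
      (use greater in \<open>auto intro!: eventually_mono[OF eventually_nhds_in_open[of "{0<..}"]]\<close>)
qed

lemma bump_deriv: "(bump has_real_derivative bump' x) (at x)"
proof -
  have "((\<lambda>x. (max 0 (1 - x\<^sup>2))\<^sup>2) has_real_derivative 2 * max 0 (1 - x\<^sup>2) * (- 2 * x)) (at x)"
    by (rule DERIV_chain2[OF square_pos_part_deriv]) (auto intro!: derivative_eq_intros)
  then show ?thesis unfolding bump_def[abs_def] bump'_def by (simp add: mult_ac)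
qed

lemma nonzero_int_square: "(i :: int) \<noteq> 0 \<Longrightarrow> 1 - (real_of_int i)\<^sup>2 \<le> 0"
proof -
  assume "i \<noteq> 0"
  then have "1 \<le> i\<^sup>2" by (simp add: int_one_le_iff_zero_less)
  then have "1 \<le> (real_of_int i)\<^sup>2" by (metis of_int_1_le_iff of_int_power)
  then show ?thesis by simp
qed

lemma bump_int: "bump (real_of_int i) = of_bool (i = 0)" "bump' (real_of_int i) = 0"
  using nonzero_int_square[of i] by (cases "i = 0"; simp add: bump_def bump'_def max_absorb1)+

lemma Ck_1_product:
  assumes a: "\<And>x. (a has_real_derivative a' x) (at x)" and b: "\<And>x. (b has_real_derivative b' x) (at x)"
    and c: "continuous_on UNIV a'" "continuous_on UNIV b'"
  shows "Ck 1 (\<lambda>(x, y). a x * b y)"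
    and "partial_x (\<lambda>(x, y). a x * b y) = (\<lambda>(x, y). a' x * b y)"
    and "partial_y (\<lambda>(x, y). a x * b y) = (\<lambda>(x, y). a x * b' y)"
proof -
  have *: "((\<lambda>t. (\<lambda>(x, y). a x * b y) (t, y)) has_real_derivative (\<lambda>(x, y). a' x * b y) (x, y)) (at x)"
    "((\<lambda>t. (\<lambda>(x, y). a x * b y) (x, t)) has_real_derivative (\<lambda>(x, y). a x * b' y) (x, y)) (at y)" for x y
    using a b by (auto intro!: derivative_eq_intros)
  note p = partials_eqI[of "\<lambda>(x, y). a x * b y", OF *]
  then show "partial_x (\<lambda>(x, y). a x * b y) = (\<lambda>(x, y). a' x * b y)"
    "partial_y (\<lambda>(x, y). a x * b y) = (\<lambda>(x, y). a x * b' y)" by blast+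
  have "continuous_on UNIV a" "continuous_on UNIV b"
    using a b by (auto intro!: DERIV_atLeastAtMost_imp_continuous_on continuous_at_imp_continuous_on DERIV_isCont)
  then have "continuous_on UNIV (\<lambda>(x, y). u x * v y)" if "u \<in> {a, a'}" "v \<in> {b, b'}" for u v
    unfolding case_prod_unfold using that c
    by (auto intro!: continuous_intros intro: continuous_on_compose2[OF _ continuous_on_fst] continuous_on_compose2[OF _ continuous_on_snd])
  then show "Ck 1 (\<lambda>(x, y). a x * b y)"
    using p unfolding One_nat_def Ck_Suc_iff by simp
qed

text \<open>
  The entry of a mask that acts on the data at the origin when the stencil is centred at $(i, j)$, and $0$ if the
  origin does not belong to that stencil.
\<close>
definition mask_entry :: "real ^ 7 \<Rightarrow> int \<Rightarrow> int \<Rightarrow> real" where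
  "mask_entry w i j = w \<bullet> stencil 1 (\<lambda>z. of_bool (z = 0)) i j"

lemma vtx_1_eq_0_iff: "vtx 1 i j = 0 \<longleftrightarrow> i = 0 \<and> j = 0"
proof -
  have "vtx 1 i j = (real_of_int (i + j), real_of_int (i - j))" by (simp add: vtx_def)
  then show ?thesis unfolding zero_prod_def by (simp del: of_int_add of_int_diff) arith
qed

lemma mask_entry_eq:
  "mask_entry w i j =
     w $ 0 * of_bool (i = 0 \<and> j = 0) + w $ 1 * of_bool (i + 1 = 0 \<and> j + 1 = 0)
   + w $ 2 * of_bool (i + 1 = 0 \<and> j = 0) + w $ 3 * of_bool (i = 0 \<and> j - 1 = 0)
   + w $ 4 * of_bool (i - 1 = 0 \<and> j - 1 = 0) + w $ 5 * of_bool (i - 1 = 0 \<and> j = 0)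
   + w $ 6 * of_bool (i = 0 \<and> j + 1 = 0)"
  unfolding mask_entry_def inner_stencil vtx_1_eq_0_iff ..

text \<open>
  Each of the three masks of a functional can be read off from its action on one test function.
\<close>
lemma mask_entry_test_function:
  assumes sel: "sel \<in> {m00, m10, m01}"
  obtains f where "Ck 1 f" "\<And>m i j. mask_apply 1 m f i j = mask_entry (sel m) i j"
proof -
  have st: "stencil 1 g i j = stencil 1 (\<lambda>z. of_bool (z = 0)) i j"
    if "\<And>i j. g (vtx 1 i j) = of_bool (i = 0 \<and> j = 0)" for g i j
    unfolding stencil_def that vtx_1_eq_0_iff ..
  have st0: "stencil 1 g i j = 0" if "\<And>i j. g (vtx 1 i j) = 0" for g i j
    unfolding stencil_def that by (simp add: vec_eq_iff)
  have vtx: "vtx 1 i j = (real_of_int (i + j), real_of_int (i - j))" for i j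
    by (simp add: vtx_def)
  have zero: "i + j = 0 \<and> i - j = 0 \<longleftrightarrow> i = 0 \<and> j = 0" for i j :: int by arith
  define a1 where "a1 = (\<lambda>x. x * bump x)"
  define a1' where "a1' = (\<lambda>x. bump x + x * bump' x)"
  have a1: "(a1 has_real_derivative a1' x) (at x)" for x
    unfolding a1_def a1'_def by (auto intro!: derivative_eq_intros bump_deriv)
  have cont: "continuous_on UNIV bump'" "continuous_on UNIV a1'"
    unfolding a1'_def bump'_def[abs_def] bump_def[abs_def] by (auto intro!: continuous_intros)
  have a1_int: "a1 (real_of_int i) = 0" "a1' (real_of_int i) = of_bool (i = 0)" for i
    unfolding a1_def a1'_def bump_int by auto
  have prod: "(\<lambda>(x, y). a x * b y) (vtx 1 i j)
      = a (real_of_int (i + j)) * b (real_of_int (i - j))" for a b :: "real \<Rightarrow> real" and i j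
    by (simp add: vtx_def)
  have one: "of_bool (i + j = 0) * of_bool (i - j = 0) = (of_bool (i = 0 \<and> j = 0) :: real)"
    for i j :: int by (simp only: of_bool_conj[symmetric] zero)
  note ints = prod bump_int a1_int one mult_zero_left mult_zero_right
  have unit: "stencil 1 (\<lambda>(x, y). a x * b y) i j = stencil 1 (\<lambda>z. of_bool (z = 0)) i j"
    if "a \<in> {bump, a1'}" "b \<in> {bump, a1'}" for a b i j
    using that by (intro st) (auto simp only: ints insert_iff empty_iff)
  have null: "stencil 1 (\<lambda>(x, y). a x * b y) i j = 0"
    if "a \<in> {bump', a1} \<or> b \<in> {bump', a1}" for a b i j
    using that by (intro st0) (auto simp only: ints insert_iff empty_iff)
  consider "sel = m00" | "sel = m10" | "sel = m01" using sel by blast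
  then show ?thesis
  proof cases
    case 1
    note P = Ck_1_product[OF bump_deriv bump_deriv cont(1) cont(1)]
    show ?thesis
      by (rule that[OF P(1)]) (simp add: mask_apply_def P(2,3) mask_entry_def 1 unit null)
  next
    case 2
    note P = Ck_1_product[OF a1 bump_deriv cont(2) cont(1)]
    show ?thesis
      by (rule that[OF P(1)]) (simp add: mask_apply_def P(2,3) mask_entry_def 2 unit null)
  next
    case 3
    note P = Ck_1_product[OF bump_deriv a1 cont(1) cont(2)]
    show ?thesis
      by (rule that[OF P(1)]) (simp add: mask_apply_def P(2,3) mask_entry_def 3 unit null)
  qed
qed

text \<open>
  Here $v$, $x$, $y$, $g$, $g'$ stand for one kind of data in $V$, $U^{1,0}$, $U^{0,1}$, $C$, $\widetilde{C}$,
  and the hypotheses are the smoothness relations of the central coefficients on the three families of sides, with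
  the other functionals eliminated by means of the relations at the vertices. They hold at all
  lattice points, while all entries outside the stencil vanish; equations centred at the rim of the stencil
  therefore have few terms. With the lattice shifts $S$ and $T$ the system says that $g$ and $g'$ are
  quotients of Laurent polynomials by $S - 1$ and $T - 1$, and divisibility together with the small supports
  leaves only four degrees of freedom in $v$. Each conclusion is a rational linear combination of the
  instances listed for it.
\<close>
lemma hexagon_system:
  fixes v x y g g' :: "real ^ 7"
  assumes R1: "\<And>i j. mask_entry g i j + mask_entry g' i j
      = mask_entry x i j + mask_entry y i j - mask_entry v i j
        + (3 * mask_entry v (i + 1) (j + 1) - mask_entry x (i + 1) (j + 1) - mask_entry y (i + 1) (j + 1))"
    and R2: "\<And>i j. mask_entry g i j + mask_entry g' i (j - 1)
      = mask_entry x i j + (2 * mask_entry v (i + 1) j - mask_entry x (i + 1) j)"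
    and R3: "\<And>i j. mask_entry g' i j + mask_entry g (i - 1) j
      = mask_entry y i j + (2 * mask_entry v i (j + 1) - mask_entry y i (j + 1))"
  shows "v $ 1 = 0" "v $ 0 = v $ 3 + v $ 5" "v $ 6 = v $ 5 + v $ 3 - v $ 2 - v $ 4"
    and "x $ 0 = v $ 3 + 2 * v $ 5 - v $ 2" "x $ 1 = 0" "x $ 2 = 2 * v $ 2" "x $ 3 = 2 * v $ 3 - v $ 2"
      "x $ 4 = v $ 4 - v $ 3 + v $ 2" "x $ 5 = 0" "x $ 6 = v $ 6"
proof -
  note r1 = R1[unfolded mask_entry_eq] and r2 = R2[unfolded mask_entry_eq] and r3 = R3[unfolded mask_entry_eq]
  show "v $ 1 = 0" "x $ 1 = 0"
    using r1[of "-2" "-2", simplified] r2[of "-2" "-1", simplified] r3[of "-1" "-2", simplified] by linarith+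
  show x5: "x $ 5 = 0"
    using r2[of 1 0, simplified] r3[of 2 0, simplified] by linarith
  show x2: "x $ 2 = 2 * v $ 2"
    using r2[of "-2" 0, simplified] by linarith
  show x3: "x $ 3 = 2 * v $ 3 - v $ 2"
    using r1[of "-2" "-1", simplified] r2[of "-2" 0, simplified] r2[of "-1" 1, simplified] r3[of "-1" 0, simplified] by linarith
  show x6: "x $ 6 = v $ 6"
    using r1[of "-1" "-2", simplified] r3[of 0 "-2", simplified] by linarith
  show x4: "x $ 4 = v $ 4 - v $ 3 + v $ 2"
    using r1[of "-2" "-1", simplified] r1[of 0 1, simplified] r1[of 1 1, simplified]
      r2[of "-2" 0, simplified] r2[of "-1" 1, simplified]
      r3[of "-1" 0, simplified] r3[of 0 1, simplified] r3[of 1 1, simplified] r3[of 2 1, simplified] by linarith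
  show v6: "v $ 6 = v $ 5 + v $ 3 - v $ 2 - v $ 4"
    using r1[of "-2" "-1", simplified] r1[of "-1" "-2", simplified] r1[of 0 1, simplified] r1[of 1 0, simplified]
      r1[of 1 1, simplified] r2[of "-2" 0, simplified] r2[of "-1" 1, simplified] r2[of 0 "-1", simplified]
      r2[of 1 0, simplified] r2[of 1 1, simplified] r3[of "-1" 0, simplified] r3[of 0 "-2", simplified]
      r3[of 0 1, simplified] r3[of 1 "-1", simplified] r3[of 1 1, simplified] by linarith
  show v0: "v $ 0 = v $ 3 + v $ 5"
    using r1[of "-2" "-2", simplified] r1[of "-2" "-1", simplified] r1[of "-1" "-2", simplified]
      r1[of "-1" "-1", simplified] r1[of "-1" 0, simplified] r1[of 0 "-1", simplified]
      r2[of "-2" "-1", simplified] r2[of "-2" 0, simplified] r2[of "-1" 0, simplified] r2[of "-1" 1, simplified]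
      r2[of 0 2, simplified] r2[of 1 0, simplified]
      r3[of "-1" "-2", simplified] r3[of 0 "-2", simplified] r3[of 0 "-1", simplified] r3[of 0 1, simplified]
      r3[of 1 "-1", simplified] r3[of 2 0, simplified] by linarith
  show "x $ 0 = v $ 3 + 2 * v $ 5 - v $ 2"
    using r1[of "-2" "-1", simplified] r1[of "-1" "-2", simplified] r1[of 0 "-1", simplified]
      r1[of 0 1, simplified] r1[of 1 0, simplified] r1[of 1 1, simplified]
      r2[of "-2" 0, simplified] r2[of "-1" 1, simplified] r2[of 0 "-1", simplified] r2[of 0 0, simplified]
      r2[of 1 0, simplified] r2[of 1 1, simplified] r2[of 1 2, simplified]
      r3[of "-1" 0, simplified] r3[of 0 "-2", simplified] r3[of 0 1, simplified] r3[of 1 "-1", simplified]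
      r3[of 1 0, simplified] r3[of 1 1, simplified] by linarith
qed

context exact_C1_masks
begin

lemma mask_structure:
  assumes sel: "sel \<in> {m00, m10, m01}"
  defines "v \<equiv> sel (\<alpha> M)" and "x \<equiv> sel (\<beta> M 1 0)"
  shows "v $ 1 = 0" "v $ 0 = v $ 3 + v $ 5" "v $ 6 = v $ 5 + v $ 3 - v $ 2 - v $ 4"
    and "x $ 0 = v $ 3 + 2 * v $ 5 - v $ 2" "x $ 1 = 0" "x $ 2 = 2 * v $ 2" "x $ 3 = 2 * v $ 3 - v $ 2"
      "x $ 4 = v $ 4 - v $ 3 + v $ 2" "x $ 5 = 0" "x $ 6 = v $ 6"
proof -
  obtain f where f: "Ck 1 f" and E: "\<And>m i j. mask_apply 1 m f i j = mask_entry (sel m) i j"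
    using mask_entry_test_function[OF sel] by blast
  have pd: "partially_differentiable (quasi_interp M 1 f)"
    by (rule smooth_partially_differentiable[OF _ f]) simp
  note rel = join_diagonal[OF _ pd, unfolded E] join_first[OF _ pd, unfolded E]
    join_second[OF _ pd, unfolded E] opposite_sum[OF _ pd, unfolded E]
  note S = hexagon_system[of "sel (\<gamma> M)" "sel (\<gamma>' M)" "sel (\<beta> M 1 0)" "sel (\<beta> M 0 1)" "sel (\<alpha> M)"]
  have "mask_entry (sel (\<gamma> M)) i j + mask_entry (sel (\<gamma>' M)) i j
      = mask_entry x i j + mask_entry (sel (\<beta> M 0 1)) i j - mask_entry v i j
        + (3 * mask_entry v (i + 1) (j + 1) - mask_entry x (i + 1) (j + 1)
           - mask_entry (sel (\<beta> M 0 1)) (i + 1) (j + 1))" for i j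
    using rel(1)[of i j] rel(1)[of "i + 1" "j + 1"] rel(2)[of i j] rel(12)[of "i + 1" "j + 1"]
    unfolding v_def x_def by simp
  moreover have "mask_entry (sel (\<gamma> M)) i j + mask_entry (sel (\<gamma>' M)) i (j - 1)
      = mask_entry x i j + (2 * mask_entry v (i + 1) j - mask_entry x (i + 1) j)" for i j
    using rel(5)[of i j] rel(10)[of "i + 1" j] unfolding v_def x_def by simp
  moreover have "mask_entry (sel (\<gamma>' M)) i j + mask_entry (sel (\<gamma> M)) (i - 1) j
      = mask_entry (sel (\<beta> M 0 1)) i j
        + (2 * mask_entry v i (j + 1) - mask_entry (sel (\<beta> M 0 1)) i (j + 1))" for i j
    using rel(8)[of i j] rel(11)[of i "j + 1"] unfolding v_def x_def by simp
  ultimately show "v $ 1 = 0" "v $ 0 = v $ 3 + v $ 5" "v $ 6 = v $ 5 + v $ 3 - v $ 2 - v $ 4"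
    and "x $ 0 = v $ 3 + 2 * v $ 5 - v $ 2" "x $ 1 = 0" "x $ 2 = 2 * v $ 2" "x $ 3 = 2 * v $ 3 - v $ 2"
      "x $ 4 = v $ 4 - v $ 3 + v $ 2" "x $ 5 = 0" "x $ 6 = v $ 6"
    by (rule hexagon_system)+
qed

text \<open>
  The list gives the index of each entry of a stencil at the origin together with the coordinates of its lattice
  point, for $h = 1$.
\<close>
lemma mask_apply_monom2:
  "mask_apply 1 m (monom2 a b) 0 0 =
     (\<Sum>(l, x, y) \<leftarrow> [(0, 0, 0), (1, 2, 0), (2, 1, 1), (3, -1, 1), (4, -2, 0), (5, -1, -1), (6, 1, -1)].
       m00 m $ l * (x ^ a * y ^ b) + m10 m $ l * (a * (x ^ (a - 1) * y ^ b)) + m01 m $ l * (b * (x ^ a * y ^ (b - 1))))"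
  unfolding mask_apply_def partials_monom2 inner_stencil
  by (simp add: monom2_def vtx_def algebra_simps)

text \<open>
  Besides the six conditions that $V$ is exact on quadratics, one condition on $U^{1,0}$ enters. The
  polynomial $x^2 - y^2$ vanishes to second order at the origin and vanishes on the line of the first lattice
  direction, so $U^{1,0}$ annihilates it.
\<close>
lemma cubic_exactness_iff:
  "(\<forall>a b. a + b = 3 \<longrightarrow> mask_apply 1 (\<alpha> M) (monom2 a b) 0 0 = 0) \<longleftrightarrow>
    (\<exists>lam :: real.
        m00 (\<alpha> M) $ 2 = lam
      \<and> m00 (\<alpha> M) $ 3 = 1 / 6 * (- 5 + 12 * lam)
      \<and> m10 (\<alpha> M) $ 2 = 1 / 36 * (1 - 18 * lam)
      \<and> m10 (\<alpha> M) $ 3 = 1 / 12 * (5 - 18 * lam)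
      \<and> m01 (\<alpha> M) $ 2 = - 1 / 9)"
proof -
  have S: "m00 \<in> {m00, m10, m01}" "m10 \<in> {m00, m10, m01}" "m01 \<in> {m00, m10, m01}" by auto
  note struct = mask_structure[OF S(1)] mask_structure[OF S(2)] mask_structure[OF S(3)]
  have V: "mask_apply 1 (\<alpha> M) (monom2 a b) 0 0 = of_bool (a = 0 \<and> b = 0)" if "a + b \<le> 2" for a b
    using vertex_exact[OF _ monom2_in_polys[OF that], of 1 0 0]
    by (simp add: vtx_0 zero_prod_def monom2_def power_0_left)
  have q: "(\<lambda>z. 1 * monom2 2 0 z + (- 1) * monom2 0 2 z) \<in> polys_upto 2"
    unfolding polys_upto_2_iff monom2_def
    by (rule exI[of _ 0], rule exI[of _ 0], rule exI[of _ 0], rule exI[of _ 1], rule exI[of _ 0],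
      rule exI[of _ "- 1"]) simp
  have U: "mask_apply 1 (\<beta> M 1 0) (monom2 2 0) 0 0 = mask_apply 1 (\<beta> M 1 0) (monom2 0 2) 0 0"
    using edge_exact[OF _ q, of 1 1 0 0 0]
    unfolding mask_apply_lincomb[OF partials_monom2(1) partials_monom2(1)]
    by (simp add: side_dirs_def vtx_def monom2_def)
  have split3: "(\<forall>a b. a + b = 3 \<longrightarrow> P a b) \<longleftrightarrow> P 3 0 \<and> P 2 1 \<and> P 1 2 \<and> P 0 3" for P :: "nat \<Rightarrow> nat \<Rightarrow> bool"
  proof -
    have "a + b = 3 \<longleftrightarrow> (a = 3 \<and> b = 0) \<or> (a = 2 \<and> b = 1) \<or> (a = 1 \<and> b = 2) \<or> (a = 0 \<and> b = 3)" for a b :: nat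
      by arith
    then show ?thesis by metis
  qed
  \<comment> \<open>Seven independent conditions on the twelve entries left free by the structure of the masks.\<close>
  note quadratics = V[of 0 0, simplified] V[of 1 0, simplified] V[of 0 1, simplified]
    V[of 2 0, simplified] V[of 1 1, simplified] V[of 0 2, simplified] U
  note eqs = quadratics[unfolded mask_apply_monom2, simplified, unfolded struct, simplified]
  show ?thesis
    unfolding split3 mask_apply_monom2
    by (simp add: struct) (use eqs in \<open>intro iffI conjI; elim conjE; linarith\<close>)
qed

end

section \<open>Approximation by Taylor polynomials\<close>

lemma Ck_funpow_partial_y: "Ck (n + k) f \<Longrightarrow> Ck k ((partial_y ^^ n) f)"
proof (induction n arbitrary: k)
  case (Suc n)
  from Suc.IH[of "Suc k"] Suc.prems have "Ck (Suc k) ((partial_y ^^ n) f)" by simp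
  then show ?case by simp
qed simp

lemma Ck_funpow_partial_x: "Ck (m + k) f \<Longrightarrow> Ck k ((partial_x ^^ m) f)"
proof (induction m arbitrary: k)
  case (Suc m)
  from Suc.IH[of "Suc k"] Suc.prems have "Ck (Suc k) ((partial_x ^^ m) f)" by simp
  then show ?case by simp
qed simp

lemma Ck_partially_differentiable: "Ck k f \<Longrightarrow> k > 0 \<Longrightarrow> partially_differentiable f"
  using Ck_Suc_iff[of "k - 1" f] by simp

lemma Ck_partially_differentiable_funpow:
  assumes "Ck k f" "m + n < k"
  shows "partially_differentiable ((partial_x ^^ m) ((partial_y ^^ n) f))"
proof (rule Ck_partially_differentiable)
  show "Ck (k - n - m) ((partial_x ^^ m) ((partial_y ^^ n) f))"
    by (intro Ck_funpow_partial_x Ck_funpow_partial_y) (use assms in simp)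
qed (use assms in simp)

text \<open>
  Expanding first in $y$ and then in $x$ meets only the derivatives $\partial_x^a\partial_y^b f$ in this
  order, the ones whose bound is given.
\<close>
lemma taylor_polynomial:
  assumes f: "Ck 4 f"
    and K: "\<And>a b z. a + b = 4 \<Longrightarrow> \<bar>(partial_x ^^ a) ((partial_y ^^ b) f) z\<bar> \<le> K"
  obtains p where "p \<in> polys_upto 3"
    "\<And>x y r. \<bar>x - x0\<bar> \<le> r \<Longrightarrow> \<bar>y - y0\<bar> \<le> r \<Longrightarrow> \<bar>f (x, y) - p (x, y)\<bar> \<le> K * r ^ 4"
proof -
  define F where "F = (\<lambda>a b. (partial_x ^^ a) ((partial_y ^^ b) f))"
  have Fx: "((\<lambda>t. F m n (x0 + t, y)) has_real_derivative F (Suc m) n (x0 + t, y)) (at t)"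
    if "m + n < 4" for m n t y
  proof -
    have "((\<lambda>t. F m n (t, y)) has_real_derivative F (Suc m) n (x0 + t, y)) (at (x0 + t))"
      using has_partial_x[OF Ck_partially_differentiable_funpow[OF f that]] by (simp add: F_def)
    then show ?thesis using DERIV_shift[of "\<lambda>t. F m n (t, y)" _ t x0] by (simp add: add.commute)
  qed
  have Fy: "((\<lambda>t. F 0 n (x, y0 + t)) has_real_derivative F 0 (Suc n) (x, y0 + t)) (at t)"
    if "n < 4" for n t x
  proof -
    have "((\<lambda>t. F 0 n (x, t)) has_real_derivative F 0 (Suc n) (x, y0 + t)) (at (y0 + t))"
      using has_partial_y[OF Ck_partially_differentiable_funpow[OF f, of 0 n]] that by (simp add: F_def)
    then show ?thesis using DERIV_shift[of "\<lambda>t. F 0 n (x, t)" _ t y0] by (simp add: add.commute)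
  qed
  have expand_x: "\<exists>e. \<bar>e\<bar> \<le> K \<and> F 0 n (x0 + u, y0)
      = (\<Sum>m<4 - n. F m n (x0, y0) / fact m * u ^ m) + e / fact (4 - n) * u ^ (4 - n)" if "n < 4" for n u
  proof -
    have "\<forall>m t. m < 4 - n \<and> \<bar>t\<bar> \<le> \<bar>u\<bar> \<longrightarrow>
        ((\<lambda>t. F m n (x0 + t, y0)) has_real_derivative F (Suc m) n (x0 + t, y0)) (at t)"
      by (intro allI impI Fx) auto
    from Maclaurin_bi_le[OF refl this] obtain t where "F 0 n (x0 + u, y0)
      = (\<Sum>m<4 - n. F m n (x0 + 0, y0) / fact m * u ^ m) + F (4 - n) n (x0 + t, y0) / fact (4 - n) * u ^ (4 - n)"
      by blast
    moreover have "\<bar>F (4 - n) n (x0 + t, y0)\<bar> \<le> K" unfolding F_def by (rule K) (use that in simp)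
    ultimately show ?thesis by auto
  qed
  have expand_y: "\<exists>e. \<bar>e\<bar> \<le> K \<and> f (x, y0 + w)
      = (\<Sum>n<4. F 0 n (x, y0) / fact n * w ^ n) + e / fact 4 * w ^ 4" for x w
  proof -
    obtain t where "F 0 0 (x, y0 + w)
      = (\<Sum>n<4. F 0 n (x, y0 + 0) / fact n * w ^ n) + F 0 4 (x, y0 + t) / fact 4 * w ^ 4"
      using Maclaurin_bi_le[of "\<lambda>n t. F 0 n (x, y0 + t)" "\<lambda>t. F 0 0 (x, y0 + t)" 4 w] Fy by auto
    moreover have "\<bar>F 0 4 (x, y0 + t)\<bar> \<le> K" unfolding F_def by (rule K) simp
    ultimately show ?thesis by (auto simp: F_def)
  qed
  define P where "P = (\<lambda>(u, w). \<Sum>a\<le>3. \<Sum>b\<le>3 - a. (F a b (x0, y0) / (fact a * fact b)) * u ^ a * w ^ b)"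
  have "P \<in> polys_upto 3" unfolding P_def polys_upto_def
    by (intro CollectI exI[of _ "\<lambda>a b. F a b (x0, y0) / (fact a * fact b)"]) simp
  from polys_upto_3_affine[OF this, of "- (x0, y0)" 1]
  have P: "(\<lambda>z. P (z - (x0, y0))) \<in> polys_upto 3"
    by (simp only: scaleR_one uminus_add_conv_diff)
  show ?thesis
  proof (rule that[OF P])
    fix x y r assume r: "\<bar>x - x0\<bar> \<le> r" "\<bar>y - y0\<bar> \<le> r"
    define u w where "u = x - x0" and "w = y - y0"
    have xy: "x = x0 + u" "y = y0 + w" and uw: "\<bar>u\<bar> \<le> r" "\<bar>w\<bar> \<le> r"
      using r by (auto simp: u_def w_def)
    obtain e where e: "\<bar>e\<bar> \<le> K"
      "f (x, y) = (\<Sum>n<4. F 0 n (x, y0) / fact n * w ^ n) + e / fact 4 * w ^ 4"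
      using expand_y[of x w] xy by auto
    obtain e0 where e0: "\<bar>e0\<bar> \<le> K" "F 0 0 (x, y0)
      = (\<Sum>m<4. F m 0 (x0, y0) / fact m * u ^ m) + e0 / fact 4 * u ^ 4"
      using expand_x[of 0 u] xy by auto
    obtain e1 where e1: "\<bar>e1\<bar> \<le> K" "F 0 1 (x, y0)
      = (\<Sum>m<3. F m 1 (x0, y0) / fact m * u ^ m) + e1 / fact 3 * u ^ 3"
      using expand_x[of 1 u] xy by auto
    obtain e2 where e2: "\<bar>e2\<bar> \<le> K" "F 0 2 (x, y0)
      = (\<Sum>m<2. F m 2 (x0, y0) / fact m * u ^ m) + e2 / fact 2 * u ^ 2"
      using expand_x[of 2 u] xy by auto
    obtain e3 where e3: "\<bar>e3\<bar> \<le> K" "F 0 3 (x, y0)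
      = (\<Sum>m<1. F m 3 (x0, y0) / fact m * u ^ m) + e3 / fact 1 * u ^ 1"
      using expand_x[of 3 u] xy by auto
    let ?c = "\<lambda>a b. F a b (x0, y0)"
    have E0: "F 0 0 (x, y0) = ?c 0 0 + ?c 1 0 * u + ?c 2 0 / 2 * u ^ 2 + ?c 3 0 / 6 * u ^ 3 + e0 / 24 * u ^ 4"
      unfolding e0(2) by (simp add: eval_nat_numeral fact_numeral)
    have E1: "F 0 1 (x, y0) = ?c 0 1 + ?c 1 1 * u + ?c 2 1 / 2 * u ^ 2 + e1 / 6 * u ^ 3"
      unfolding e1(2) by (simp add: eval_nat_numeral fact_numeral)
    have E2: "F 0 2 (x, y0) = ?c 0 2 + ?c 1 2 * u + e2 / 2 * u ^ 2"
      unfolding e2(2) by (simp add: eval_nat_numeral fact_numeral)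
    have E3: "F 0 3 (x, y0) = ?c 0 3 + e3 * u"
      unfolding e3(2) by (simp add: eval_nat_numeral fact_numeral)
    have E: "f (x, y) = F 0 0 (x, y0) + F 0 1 (x, y0) * w + F 0 2 (x, y0) / 2 * w ^ 2
        + F 0 3 (x, y0) / 6 * w ^ 3 + e / 24 * w ^ 4"
      unfolding e(2) by (simp add: eval_nat_numeral fact_numeral)
    have P_eq: "P (u, w) = ?c 0 0 + ?c 0 1 * w + ?c 0 2 / 2 * w ^ 2 + ?c 0 3 / 6 * w ^ 3
        + ?c 1 0 * u + ?c 1 1 * u * w + ?c 1 2 / 2 * u * w ^ 2
        + ?c 2 0 / 2 * u ^ 2 + ?c 2 1 / 2 * u ^ 2 * w + ?c 3 0 / 6 * u ^ 3"
      unfolding P_def by (simp add: eval_nat_numeral fact_numeral)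
    have "f (x, y) - P (u, w) = e0 * (u ^ 4 * w ^ 0) / 24 + e1 * (u ^ 3 * w ^ 1) / 6
        + e2 * (u ^ 2 * w ^ 2) / 4 + e3 * (u ^ 1 * w ^ 3) / 6 + e * (u ^ 0 * w ^ 4) / 24"
      unfolding E E0 E1 E2 E3 P_eq by (simp add: field_simps)
    moreover have term_bound: "\<bar>c * (u ^ a * w ^ b)\<bar> \<le> K * r ^ 4" if "\<bar>c\<bar> \<le> K" "a + b = 4" for c a b
    proof -
      have "\<bar>u\<bar> ^ a * \<bar>w\<bar> ^ b \<le> r ^ a * r ^ b"
        using uw by (intro mult_mono power_mono) auto
      also have "\<dots> = r ^ 4" by (simp flip: power_add add: that(2))
      finally have "\<bar>c\<bar> * (\<bar>u\<bar> ^ a * \<bar>w\<bar> ^ b) \<le> K * r ^ 4"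
        using that(1) by (intro mult_mono) auto
      then show ?thesis by (simp add: abs_mult power_abs)
    qed
    moreover note term_bound[OF e0(1), of 4 0] term_bound[OF e1(1), of 3 1] term_bound[OF e2(1), of 2 2] term_bound[OF e3(1), of 1 3]
      term_bound[OF e(1), of 0 4]
    ultimately have "\<bar>f (x, y) - P (u, w)\<bar> \<le> K * r ^ 4"
      by linarith
    then show "\<bar>f (x, y) - P ((x, y) - (x0, y0))\<bar> \<le> K * r ^ 4"
      by (simp add: u_def w_def)
  qed
qed

text \<open>
  The one-sided difference formula for $h\,g'(0)$ that is exact on cubics.
\<close>
definition forward_diff :: "(real \<Rightarrow> real) \<Rightarrow> real \<Rightarrow> real" where
  "forward_diff g h = - 11 / 6 * g 0 + 3 * g h - 3 / 2 * g (2 * h) + 1 / 3 * g (3 * h)"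

lemma forward_diff_error:
  assumes d: "\<And>m t. m < 4 \<Longrightarrow> (d m has_real_derivative d (Suc m) t) (at t)"
    and K: "\<And>t. \<bar>d 4 t\<bar> \<le> K" and h: "h > 0"
  shows "\<bar>h * d 1 0 - forward_diff (d 0) h\<bar> \<le> 3 * K * h ^ 4"
proof -
  have T: "\<exists>e. \<bar>e\<bar> \<le> K \<and> d 0 x = d 0 0 + d 1 0 * x + d 2 0 / 2 * x\<^sup>2 + d 3 0 / 6 * x ^ 3 + e / 24 * x ^ 4" for x
  proof -
    obtain t where "d 0 x = (\<Sum>m<4. d m 0 / fact m * x ^ m) + d 4 t / fact 4 * x ^ 4"
      using Maclaurin_bi_le[of d "d 0" 4 x] d by auto
    then show ?thesis using K[of t] by (intro exI[of _ "d 4 t"]) (simp add: eval_nat_numeral fact_numeral)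
  qed
  obtain e1 where e1: "\<bar>e1\<bar> \<le> K" "d 0 h = d 0 0 + d 1 0 * h + d 2 0 / 2 * h\<^sup>2 + d 3 0 / 6 * h ^ 3 + e1 / 24 * h ^ 4"
    using T by blast
  obtain e2 where e2: "\<bar>e2\<bar> \<le> K" "d 0 (2 * h) = d 0 0 + d 1 0 * (2 * h) + d 2 0 / 2 * (2 * h)\<^sup>2
      + d 3 0 / 6 * (2 * h) ^ 3 + e2 / 24 * (2 * h) ^ 4" using T by blast
  obtain e3 where e3: "\<bar>e3\<bar> \<le> K" "d 0 (3 * h) = d 0 0 + d 1 0 * (3 * h) + d 2 0 / 2 * (3 * h)\<^sup>2
      + d 3 0 / 6 * (3 * h) ^ 3 + e3 / 24 * (3 * h) ^ 4" using T by blast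
  \<comment> \<open>The Taylor terms of degree at most three cancel; the fourth powers $1, 16, 81$ remain.\<close>
  have "h * d 1 0 - forward_diff (d 0) h = (- e1 / 8 + e2 - 9 / 8 * e3) * h ^ 4"
    unfolding forward_diff_def e1(2) e2(2) e3(2) by (simp add: power2_eq_square power_mult_distrib field_simps)
  also have "\<bar>\<dots>\<bar> \<le> (3 * K) * h ^ 4"
    unfolding abs_mult using e1(1) e2(1) e3(1) h by (intro mult_mono) auto
  finally show ?thesis .
qed

lemma forward_diff_cubic:
  assumes "p \<in> polys_upto 3"
  shows "h * partial_x p (x, y) = forward_diff (\<lambda>t. p (x + t, y)) h"
    and "h * partial_y p (x, y) = forward_diff (\<lambda>t. p (x, y + t)) h"
proof -
  note pd = partially_differentiable_polys[OF assms]
  from polys_upto_3_on_line[OF assms, of "(x, y)" "(1, 0)"] obtain c0 c1 c2 c3 where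
    "p ((x, y) + t *\<^sub>R (1, 0)) = c0 + c1 * t + c2 * t\<^sup>2 + c3 * t ^ 3" for t by blast
  then have c: "p (x + t, y) = c0 + c1 * t + c2 * t\<^sup>2 + c3 * t ^ 3" for t by simp
  have "((\<lambda>t. p (t, y)) has_real_derivative partial_x p (x, y)) (at (0 + x))"
    using has_partial_x[OF pd] by simp
  then have "((\<lambda>t. p (x + t, y)) has_real_derivative partial_x p (x, y)) (at 0)"
    using DERIV_shift[of "\<lambda>t. p (t, y)" _ 0 x] by (simp add: add.commute)
  moreover have "((\<lambda>t. p (x + t, y)) has_real_derivative c1) (at 0)"
    unfolding c by (auto intro!: derivative_eq_intros)
  ultimately have "partial_x p (x, y) = c1" using DERIV_unique by blast
  then show "h * partial_x p (x, y) = forward_diff (\<lambda>t. p (x + t, y)) h"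
    unfolding forward_diff_def c using c[of 0] by (simp add: power2_eq_square power3_eq_cube field_simps)
  from polys_upto_3_on_line[OF assms, of "(x, y)" "(0, 1)"] obtain c0 c1 c2 c3 where
    "p ((x, y) + t *\<^sub>R (0, 1)) = c0 + c1 * t + c2 * t\<^sup>2 + c3 * t ^ 3" for t by blast
  then have c: "p (x, y + t) = c0 + c1 * t + c2 * t\<^sup>2 + c3 * t ^ 3" for t by simp
  have "((\<lambda>t. p (x, t)) has_real_derivative partial_y p (x, y)) (at (0 + y))"
    using has_partial_y[OF pd] by simp
  then have "((\<lambda>t. p (x, y + t)) has_real_derivative partial_y p (x, y)) (at 0)"
    using DERIV_shift[of "\<lambda>t. p (x, t)" _ 0 y] by (simp add: add.commute)
  moreover have "((\<lambda>t. p (x, y + t)) has_real_derivative c1) (at 0)"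
    unfolding c by (auto intro!: derivative_eq_intros)
  ultimately have "partial_y p (x, y) = c1" using DERIV_unique by blast
  then show "h * partial_y p (x, y) = forward_diff (\<lambda>t. p (x, y + t)) h"
    unfolding forward_diff_def c using c[of 0] by (simp add: power2_eq_square power3_eq_cube field_simps)
qed

lemma forward_diff_bound:
  assumes "\<And>t. t \<in> {0, h, 2 * h, 3 * h} \<Longrightarrow> \<bar>a t - b t\<bar> \<le> B"
  shows "\<bar>forward_diff a h - forward_diff b h\<bar> \<le> 7 * B"
  using assms[of 0] assms[of h] assms[of "2 * h"] assms[of "3 * h"]
  unfolding forward_diff_def by simp

text \<open>
  A bound for the remainder yields one for its gradient: the difference formula expresses $h$ times a derivative
  through values, up to the fourth pure derivative. Thus mixed derivatives of the gradient, in an order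
  for which no bound is given, do not arise. The factor $7$ exceeds the sum of the absolute values of the weights.
\<close>
lemma partials_remainder_bound:
  assumes f: "Ck 4 f" and p: "p \<in> polys_upto 3" and h: "h > 0"
    and K: "\<And>a b z. a + b = 4 \<Longrightarrow> \<bar>(partial_x ^^ a) ((partial_y ^^ b) f) z\<bar> \<le> K"
    and near: "\<And>s t. s \<in> {0..3 * h} \<Longrightarrow> t \<in> {0..3 * h} \<Longrightarrow> \<bar>f (x + s, y + t) - p (x + s, y + t)\<bar> \<le> B"
  shows "\<bar>h * (partial_x f (x, y) - partial_x p (x, y))\<bar> \<le> 3 * K * h ^ 4 + 7 * B"
    and "\<bar>h * (partial_y f (x, y) - partial_y p (x, y))\<bar> \<le> 3 * K * h ^ 4 + 7 * B"
proof -
  have "((\<lambda>t. (partial_x ^^ m) f (x + t, y)) has_real_derivative (partial_x ^^ Suc m) f (x + t, y)) (at t)"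
    if "m < 4" for m t
    using has_partial_x[OF Ck_partially_differentiable_funpow[OF f, of m 0], of y "x + t"] that
      DERIV_shift[of "\<lambda>t. (partial_x ^^ m) f (t, y)" _ t x] by (simp add: add.commute)
  from forward_diff_error[of "\<lambda>m t. (partial_x ^^ m) f (x + t, y)", OF this _ h] K[of 4 0]
  have "\<bar>h * partial_x f (x, y) - forward_diff (\<lambda>t. f (x + t, y)) h\<bar> \<le> 3 * K * h ^ 4" by simp
  moreover have "\<bar>forward_diff (\<lambda>t. f (x + t, y)) h - forward_diff (\<lambda>t. p (x + t, y)) h\<bar> \<le> 7 * B"
    by (rule forward_diff_bound) (use near[of _ 0] near[of 0 0] h in auto)
  ultimately show "\<bar>h * (partial_x f (x, y) - partial_x p (x, y))\<bar> \<le> 3 * K * h ^ 4 + 7 * B"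
    unfolding forward_diff_cubic(1)[OF p, symmetric] right_diff_distrib by linarith
  have "((\<lambda>t. (partial_y ^^ m) f (x, y + t)) has_real_derivative (partial_y ^^ Suc m) f (x, y + t)) (at t)"
    if "m < 4" for m t
    using has_partial_y[OF Ck_partially_differentiable_funpow[OF f, of 0 m], of x "y + t"] that
      DERIV_shift[of "\<lambda>t. (partial_y ^^ m) f (x, t)" _ t y] by (simp add: add.commute)
  from forward_diff_error[of "\<lambda>m t. (partial_y ^^ m) f (x, y + t)", OF this _ h] K[of 0 4]
  have "\<bar>h * partial_y f (x, y) - forward_diff (\<lambda>t. f (x, y + t)) h\<bar> \<le> 3 * K * h ^ 4" by simp
  moreover have "\<bar>forward_diff (\<lambda>t. f (x, y + t)) h - forward_diff (\<lambda>t. p (x, y + t)) h\<bar> \<le> 7 * B"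
    by (rule forward_diff_bound) (use near[of 0] near[of 0 0] h in auto)
  ultimately show "\<bar>h * (partial_y f (x, y) - partial_y p (x, y))\<bar> \<le> 3 * K * h ^ 4 + 7 * B"
    unfolding forward_diff_cubic(2)[OF p, symmetric] right_diff_distrib by linarith
qed

lemma bounded_fourth_partialsE:
  assumes "bounded_fourth_partials f"
  obtains K where "K > 0" "\<And>a b z. a + b = 4 \<Longrightarrow> \<bar>(partial_x ^^ a) ((partial_y ^^ b) f) z\<bar> \<le> K"
proof -
  define I where "I = {(a, b). a + b = (4 :: nat)}"
  have "I \<subseteq> {..4} \<times> {..4}" by (auto simp: I_def)
  then have "finite I" by (rule finite_subset) auto
  then have "bounded (\<Union>(a, b)\<in>I. range ((partial_x ^^ a) ((partial_y ^^ b) f)))"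
    using assms by (intro bounded_Union) (auto simp: I_def bounded_fourth_partials_def)
  then obtain K where "K > 0" and K: "\<And>v. v \<in> (\<Union>(a, b)\<in>I. range ((partial_x ^^ a) ((partial_y ^^ b) f))) \<Longrightarrow> norm v \<le> K"
    unfolding bounded_pos by blast
  show ?thesis
  proof (rule that[OF \<open>K > 0\<close>])
    fix a b :: nat and z assume "a + b = 4"
    then show "\<bar>(partial_x ^^ a) ((partial_y ^^ b) f) z\<bar> \<le> K"
      using K[of "(partial_x ^^ a) ((partial_y ^^ b) f) z"] by (auto simp: I_def)
  qed
qed

lemma bounded_fourth_partials_monom2:
  assumes "a + b < 4"
  shows "bounded_fourth_partials (monom2 a b)"
  unfolding bounded_fourth_partials_def
proof (intro allI impI)
  fix m n :: nat assume mn: "m + n = 4"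
  have scale: "partial_x (\<lambda>z. c * monom2 a b z) = (\<lambda>z. (c * a) * monom2 (a - 1) b z)"
    "partial_y (\<lambda>z. c * monom2 a b z) = (\<lambda>z. (c * b) * monom2 a (b - 1) z)" for c a b
    using partials_lincomb(2,3)[OF partials_monom2(1)[of a b] partials_monom2(1)[of a b], of c 0]
    by (simp_all add: partials_monom2 mult.assoc)
  have y: "\<exists>c. (partial_y ^^ n) (monom2 a b) = (\<lambda>z. c * monom2 a (b - n) z) \<and> (b < n \<longrightarrow> c = 0)" for n
  proof (induction n)
    case 0
    then show ?case by (intro exI[of _ 1]) auto
  next
    case (Suc n)
    then obtain c where c: "(partial_y ^^ n) (monom2 a b) = (\<lambda>z. c * monom2 a (b - n) z)"
      "b < n \<longrightarrow> c = 0" by blast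
    show ?case
      by (rule exI[of _ "c * real (b - n)"]) (use c(2) in \<open>auto simp: c(1) scale\<close>)
  qed
  have x: "\<exists>c. (partial_x ^^ m) (\<lambda>z. d * monom2 a b z) = (\<lambda>z. c * monom2 (a - m) b z)
      \<and> (a < m \<longrightarrow> c = 0) \<and> (d = 0 \<longrightarrow> c = 0)" for m d b
  proof (induction m)
    case 0
    then show ?case by (intro exI[of _ d]) auto
  next
    case (Suc m)
    then obtain c where c: "(partial_x ^^ m) (\<lambda>z. d * monom2 a b z) = (\<lambda>z. c * monom2 (a - m) b z)"
      "a < m \<longrightarrow> c = 0" "d = 0 \<longrightarrow> c = 0" by blast
    show ?case
      by (rule exI[of _ "c * real (a - m)"]) (use c(2,3) in \<open>auto simp: c(1) scale\<close>)
  qed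
  have "a < m \<or> b < n" using mn assms by arith
  then have "(partial_x ^^ m) ((partial_y ^^ n) (monom2 a b)) = (\<lambda>z. 0)"
    using y[of n] x[of m] by fastforce
  then show "bounded (range ((partial_x ^^ m) ((partial_y ^^ n) (monom2 a b))))" by simp
qed

section \<open>Order four at the midpoints\<close>

lemma side_midpoints_eq:
  "side_midpoints h = {vtx h i j + (1 / 2) *\<^sub>R vtx h k l | i j k l. (k, l) \<in> side_dirs}"
proof -
  have mid: "midpoint (vtx h i j) (vtx h (i + k) (j + l)) = vtx h i j + (1 / 2) *\<^sub>R vtx h k l" for i j k l
    by (simp add: midpoint_def vtx_def field_simps)
  have kl: "k \<in> {0, 1} \<and> l \<in> {0, 1} \<and> k + l \<noteq> 0 \<longleftrightarrow> (k, l) \<in> side_dirs" for k l :: int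
    by (auto simp: side_dirs_def)
  show ?thesis unfolding side_midpoints_def mid kl ..
qed

lemma vtx_near:
  assumes "h > 0" "\<bar>k\<bar> \<le> 2" "\<bar>l\<bar> \<le> 2"
  shows "\<bar>fst (vtx h (i + k) (j + l)) - fst (vtx h i j)\<bar> \<le> 4 * h"
    and "\<bar>snd (vtx h (i + k) (j + l)) - snd (vtx h i j)\<bar> \<le> 4 * h"
proof -
  have "\<bar>real_of_int (k + l)\<bar> \<le> 4" "\<bar>real_of_int (k - l)\<bar> \<le> 4"
    using assms(2,3) by linarith+
  then have "\<bar>h * real_of_int (k + l)\<bar> \<le> h * 4" "\<bar>h * real_of_int (k - l)\<bar> \<le> h * 4"
    unfolding abs_mult using assms(1) by (auto intro!: mult_left_mono simp del: of_int_add of_int_diff)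
  then show "\<bar>fst (vtx h (i + k) (j + l)) - fst (vtx h i j)\<bar> \<le> 4 * h"
    and "\<bar>snd (vtx h (i + k) (j + l)) - snd (vtx h i j)\<bar> \<le> 4 * h"
    by (simp_all add: vtx_def algebra_simps)
qed

context exact_C1_masks
begin

lemma vertex_exact_cubic:
  assumes V: "\<And>a b. a + b = 3 \<Longrightarrow> mask_apply 1 (\<alpha> M) (monom2 a b) 0 0 = 0"
    and p: "p \<in> polys_upto 3"
  shows "mask_apply h (\<alpha> M) p i j = p (vtx h i j)"
proof -
  define p' where "p' = (\<lambda>z. p (vtx h i j + h *\<^sub>R z))"
  have "p' \<in> polys_upto 3" unfolding p'_def by (rule polys_upto_3_affine[OF p])
  then obtain q c30 c21 c12 c03 where q: "q \<in> polys_upto 2" and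
    p': "p' = (\<lambda>z. 1 * q z + 1 * (1 * (c30 * monom2 3 0 z + c21 * monom2 2 1 z)
        + 1 * (c12 * monom2 1 2 z + c03 * monom2 0 3 z)))"
    by (rule polys_upto_3_monom)
  have q': "partially_differentiable q"
    using q polys_upto_mono partially_differentiable_polys by blast
  have "mask_apply 1 (\<alpha> M) p' 0 0 = mask_apply 1 (\<alpha> M) q 0 0"
    unfolding p' by (simp only: mask_apply_lincomb partials_lincomb(1) partials_monom2(1) q' V) (simp add: V)
  also have "\<dots> = q 0" using vertex_exact[OF _ q, of 1 0 0] by (simp add: vtx_0)
  also have "\<dots> = p' 0" by (simp add: p' monom2_def zero_prod_def)
  finally show ?thesis
    unfolding mask_apply_to_unit[OF partially_differentiable_polys[OF p]] p'_def by simp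
qed

text \<open>
  With the Taylor polynomial $p$ at the near end of the side, $f - Qf = (f - p) - Q(f - p)$ at the midpoint,
  because $Q$ reproduces $p$ there. All lattice points in the stencils of both ends have coordinates within
  $4h$ of the near end, and the difference formula reaches $3h$ further, so the remainder is needed within
  $7h$; this is the source of the constant $2401 = 7^4$.
\<close>
lemma order_four_if_exact_cubic:
  assumes V: "\<And>a b. a + b = 3 \<Longrightarrow> mask_apply 1 (\<alpha> M) (monom2 a b) 0 0 = 0"
  shows "error_order_four (quasi_interp M) side_midpoints"
  unfolding error_order_four_def
proof (intro allI impI)
  fix f assume "Ck 4 f \<and> bounded_fourth_partials f"
  then have f: "Ck 4 f" and "bounded_fourth_partials f" by auto
  then obtain K where K0: "K > 0" and
    K: "\<And>a b z. a + b = 4 \<Longrightarrow> \<bar>(partial_x ^^ a) ((partial_y ^^ b) f) z\<bar> \<le> K"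
    using bounded_fourth_partialsE by blast
  have f1: "Ck 1 f" using f by (simp add: eval_nat_numeral)
  note fd = Ck_1_partially_differentiable[OF f1]
  define N where "N = mask_norm (\<alpha> M) + mask_norm (\<beta> M 1 0) + mask_norm (\<beta> M 0 1) + mask_norm (\<beta> M 1 1)"
  define c where "c = 2401 * K + N * (20000 * K)"
  have bound: "\<bar>f q - quasi_interp M h f q\<bar> \<le> c * h ^ 4"
    if h: "h > 0" and "q \<in> side_midpoints h" for h q
  proof -
    from that obtain i j k l where q: "q = vtx h i j + (1 / 2) *\<^sub>R vtx h k l"
      and kl: "(k, l) \<in> side_dirs" unfolding side_midpoints_eq by blast
    let ?v = "vtx h i j"
    obtain p where p: "p \<in> polys_upto 3" and
      "\<And>x y r. \<bar>x - fst ?v\<bar> \<le> r \<Longrightarrow> \<bar>y - snd ?v\<bar> \<le> r \<Longrightarrow> \<bar>f (x, y) - p (x, y)\<bar> \<le> K * r ^ 4"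
      by (rule taylor_polynomial[OF f K, of "fst ?v" "snd ?v"]) auto
    then have near: "\<bar>f (x, y) - p (x, y)\<bar> \<le> 2401 * K * h ^ 4"
      if "\<bar>x - fst ?v\<bar> \<le> 7 * h" "\<bar>y - snd ?v\<bar> \<le> 7 * h" for x y
      using that by (force simp: power_mult_distrib)
    note pd = partially_differentiable_polys[OF p]
    define R where "R = (\<lambda>z. 1 * f z + (- 1) * p z)"
    define B where "B = 20000 * K * h ^ 4"
    have Kh: "K * h ^ 4 \<ge> 0" using K0 h by simp
    have R_mask: "mask_apply h m R (i + a) (j + b) = mask_apply h m f (i + a) (j + b) - mask_apply h m p (i + a) (j + b)" for m a b
      unfolding R_def mask_apply_lincomb[OF fd pd] by simp
    have R_bound: "\<bar>mask_apply h m R (i + a) (j + b)\<bar> \<le> mask_norm m * B"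
      if ab: "a \<in> {0, 1}" "b \<in> {0, 1}" for m a b
    proof (rule mask_apply_bound[OF h])
      fix a' b' :: int assume a'b': "\<bar>a'\<bar> \<le> 1" "\<bar>b'\<bar> \<le> 1"
      let ?w = "vtx h (i + a + a') (j + b + b')"
      have w: "\<bar>fst ?w - fst ?v\<bar> \<le> 4 * h" "\<bar>snd ?w - snd ?v\<bar> \<le> 4 * h"
        using vtx_near[OF h, of "a + a'" "b + b'" i j] ab a'b' by (auto simp: add.assoc)
      have nearw: "\<bar>f (fst ?w + s, snd ?w + t) - p (fst ?w + s, snd ?w + t)\<bar> \<le> 2401 * K * h ^ 4"
        if "s \<in> {0..3 * h}" "t \<in> {0..3 * h}" for s t
        by (rule near) (use w that in auto)
      show "\<bar>R ?w\<bar> \<le> B"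
        using nearw[of 0 0] h Kh by (simp add: R_def B_def)
      note rem = partials_remainder_bound[OF f p h K nearw]
      \<comment> \<open>$3 + 7 \cdot 2401 \le 20000$\<close>
      have le: "3 * K * h ^ 4 + 7 * (2401 * K * h ^ 4) \<le> B" using Kh by (simp add: B_def)
      show "\<bar>h * partial_x R ?w\<bar> \<le> B"
        using rem(1) le unfolding R_def partials_lincomb[OF fd pd] by simp
      show "\<bar>h * partial_y R ?w\<bar> \<le> B"
        using rem(2) le unfolding R_def partials_lincomb[OF fd pd] by simp
    qed
    have B0: "B \<ge> 0" using Kh by (simp add: B_def)
    have ranges: "k \<in> {0, 1}" "l \<in> {0, 1}" using kl by (auto simp: side_dirs_def)
    have "quasi_interp M h p q = p q"
      using midpoint_error_cubic[OF h p kl q] vertex_exact_cubic[OF V p, of h i j] by simp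
    then have diff: "quasi_interp M h f q - p q = (mask_apply h (\<alpha> M) R i j
        + 7 * mask_apply h (\<alpha> M) R (i + k) (j + l)
        + 3 * mask_apply h (\<beta> M k l) R i j - 3 * mask_apply h (\<beta> M k l) R (i + k) (j + l)) / 8"
      using quasi_interp_at_midpoint[OF h f1 kl, of i j] quasi_interp_at_midpoint[OF h Ck_polys_3[OF p] kl, of i j]
        R_mask[of "\<alpha> M" 0 0] R_mask[of "\<alpha> M" k l] R_mask[of "\<beta> M k l" 0 0] R_mask[of "\<beta> M k l" k l]
      unfolding q by (simp add: field_simps)
    have combine: "\<bar>(v + 7 * v' + 3 * u - 3 * u') / 8\<bar> \<le> n + n'"
      if "\<bar>v\<bar> \<le> n" "\<bar>v'\<bar> \<le> n" "\<bar>u\<bar> \<le> n'" "\<bar>u'\<bar> \<le> n'" for v v' u u' n n' :: real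
      using that by argo
    have "\<bar>quasi_interp M h f q - p q\<bar> \<le> mask_norm (\<alpha> M) * B + mask_norm (\<beta> M k l) * B"
      unfolding diff
      using R_bound[of 0 0 "\<alpha> M"] R_bound[of 0 0 "\<beta> M k l"] R_bound[OF ranges]
      by (intro combine) simp_all
    also have "\<dots> = (mask_norm (\<alpha> M) + mask_norm (\<beta> M k l)) * B" by (simp add: algebra_simps)
    also have "\<dots> \<le> N * B"
      using kl B0 mask_norm_nonneg unfolding N_def
      by (intro mult_right_mono) (auto simp: side_dirs_def intro!: add_nonneg_nonneg)
    finally have "\<bar>quasi_interp M h f q - p q\<bar> \<le> N * B" .
    moreover have "\<bar>f q - p q\<bar> \<le> 2401 * K * h ^ 4"
    proof -
      have "\<bar>fst q - fst ?v\<bar> \<le> 7 * h" "\<bar>snd q - snd ?v\<bar> \<le> 7 * h"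
        using h ranges unfolding q by (auto simp: vtx_def)
      then show ?thesis using near[of "fst q" "snd q"] by simp
    qed
    ultimately show ?thesis unfolding c_def B_def by (simp add: algebra_simps)
  qed
  have "\<forall>\<^sub>F h in at_right 0. (SUP q\<in>side_midpoints h. ereal \<bar>f q - quasi_interp M h f q\<bar>) \<le> ereal (c * h ^ 4)"
    unfolding eventually_at_right_field
    by (intro exI[of _ 1]) (auto intro!: SUP_least bound)
  then show "\<exists>c. \<forall>\<^sub>F h in at_right 0. (SUP q\<in>side_midpoints h. ereal \<bar>f q - quasi_interp M h f q\<bar>) \<le> ereal (c * h ^ 4)" ..
qed

text \<open>
  On a homogeneous cubic the error at a midpoint is exactly a constant times $h^3$, which is not $O(h^4)$
  unless the constant vanishes.
\<close>
lemma exact_cubic_if_order_four: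
  assumes order: "error_order_four (quasi_interp M) side_midpoints" and ab: "a + b = 3"
  shows "mask_apply 1 (\<alpha> M) (monom2 a b) 0 0 = 0"
proof -
  let ?E = "mask_apply 1 (\<alpha> M) (monom2 a b) 0 0"
  have p: "monom2 a b \<in> polys_upto 3" using ab by (intro monom2_in_polys) simp
  have "bounded_fourth_partials (monom2 a b)" using ab by (intro bounded_fourth_partials_monom2) simp
  with order Ck_monom2 obtain c where
    c: "\<forall>\<^sub>F h in at_right 0. (SUP q\<in>side_midpoints h. ereal \<bar>monom2 a b q - quasi_interp M h (monom2 a b) q\<bar>)
      \<le> ereal (c * h ^ 4)"
    unfolding error_order_four_def by blast
  have scale: "mask_apply h (\<alpha> M) (monom2 a b) 0 0 = h ^ 3 * ?E" for h
  proof -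
    have hom: "(\<lambda>z. monom2 a b (vtx h 0 0 + h *\<^sub>R z)) = (\<lambda>z. h ^ 3 * monom2 a b z + 0 * monom2 a b z)"
      using ab by (auto simp: fun_eq_iff monom2_def vtx_0 power_mult_distrib mult_ac simp flip: power_add)
    show ?thesis
      unfolding mask_apply_to_unit[OF partials_monom2(1), of h] hom
        mask_apply_lincomb[OF partials_monom2(1) partials_monom2(1)] by simp
  qed
  have "\<forall>\<^sub>F h in at_right 0. \<bar>?E\<bar> \<le> c * h"
    using c eventually_at_right_less[of 0]
  proof eventually_elim
    case (elim h)
    let ?q = "vtx h 0 0 + (1 / 2) *\<^sub>R vtx h 1 0"
    have kl: "(1, 0) \<in> side_dirs" by (simp add: side_dirs_def)
    have "?q \<in> side_midpoints h" unfolding side_midpoints_eq using kl by blast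
    then have "ereal \<bar>monom2 a b ?q - quasi_interp M h (monom2 a b) ?q\<bar> \<le> ereal (c * h ^ 4)"
      using elim(1) by (rule order_trans[OF SUP_upper])
    moreover have "monom2 a b (vtx h 0 0) = 0"
      using ab by (cases a) (auto simp: vtx_0 monom2_def zero_prod_def)
    then have "quasi_interp M h (monom2 a b) ?q - monom2 a b ?q = h ^ 3 * ?E"
      using midpoint_error_cubic[OF elim(2) p kl refl, of 0 0] unfolding scale[of h] by linarith
    ultimately have "\<bar>h ^ 3 * ?E\<bar> \<le> c * h ^ 4" by (metis abs_minus_commute ereal_less_eq(3))
    moreover have "\<bar>h ^ 3 * ?E\<bar> = h ^ 3 * \<bar>?E\<bar>" using elim(2) by (simp add: abs_mult)
    moreover have "c * h ^ 4 = h ^ 3 * (c * h)" by (simp add: eval_nat_numeral)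
    ultimately have "h ^ 3 * \<bar>?E\<bar> \<le> h ^ 3 * (c * h)" by linarith
    moreover have "h ^ 3 > 0" using elim(2) by simp
    ultimately show ?case by (rule mult_left_le_imp_le)
  qed
  moreover have "((\<lambda>h. c * h) \<longlongrightarrow> c * 0) (at_right 0)" by (intro tendsto_intros)
  ultimately have "\<bar>?E\<bar> \<le> c * 0"
    by (intro tendsto_lowerbound[where F = "at_right 0" and f = "\<lambda>h. c * h"]) auto
  then show ?thesis by simp
qed

end

theorem proposition3:
  fixes M :: masks
  assumes exact: "\<And>h p. h > 0 \<Longrightarrow> p \<in> polys_upto 2 \<Longrightarrow> quasi_interp M h p = p"
    and smooth: "\<And>h f. h > 0 \<Longrightarrow> Ck 1 f \<Longrightarrow> quasi_interp M h f \<in> S31 h"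
  shows "error_order_four (quasi_interp M) side_midpoints \<longleftrightarrow>
    (\<exists>lam :: real.
        m00 (\<alpha> M) $ 2 = lam
      \<and> m00 (\<alpha> M) $ 3 = 1 / 6 * (- 5 + 12 * lam)
      \<and> m10 (\<alpha> M) $ 2 = 1 / 36 * (1 - 18 * lam)
      \<and> m10 (\<alpha> M) $ 3 = 1 / 12 * (5 - 18 * lam)
      \<and> m01 (\<alpha> M) $ 2 = - 1 / 9)"
proof -
  interpret exact_C1_masks M by unfold_locales (fact exact, fact smooth)
  show ?thesis
    unfolding cubic_exactness_iff[symmetric]
    using order_four_if_exact_cubic exact_cubic_if_order_four by blast
qed

end
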